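(* The variety $\mathbf{V}(\mathrm{Rel}^i(+,\cdot,\circ,0,1))$ generated by the class of integral relation algebras of similarity type $(+,\cdot,\circ,0,1)$ is axiomatized by the set of equations $\mathrm{Ax}^i(+,\cdot,\circ,0,1)$.
   Context: An algebra $\mathfrak{A}=(A,+,\cdot,\circ,0,1)$ is a relation algebra (of this signature) if there is a set $U$ with $A\subseteq\wp(U\times U)$, where $+$ is union, $\cdot$ is intersection, $\circ$ is relational composition $a\circ b=\{(u,v): \exists w\,((u,w)\in a,(w,v)\in b)\}$, $1$ is the identity relation on $U$ and $0$ is the empty relation. Such an algebra is integral if $1$ is an atom, i.e. a minimal nonzero element of $A$. $\mathrm{Rel}^i(+,\cdot,\circ,0,1)$ is the class of integral relation algebras of this signature, and $\mathbf{V}(K)$ denotes the variety generated by a class $K$. Conventions: $x\le y$ abbreviates $x\cdot y=x$; $\circ$ binds tighter than $\cdot$ and $+$. $\mathrm{Ax}^i(+,\cdot,\circ,0,1)$ consists of: the distributive lattice axioms for $+$ and $\cdot$; the monoid axioms for $\circ$ and $1$; monotonicity $(x\cdot x')\circ(y\cdot y')\le x\circ y$; $0=0\cdot x$; $0=0\circ x=x\circ 0$; $(1\cdot x)\circ(1\cdot y)=1\cdot x\cdot y$; $(1\cdot x)\circ(y\cdot z)=((1\cdot x)\circ y)\cdot z$; $(x\cdot y)\circ(1\cdot z)=x\cdot (y\circ(1\cdot z))$; $1\cdot(x\circ y)=1\cdot(y\circ x)$; $(1\cdot x)\circ y=y\circ(1\cdot x)$; and additivity $(x+y)\circ z=x\circ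 z+y\circ z$, $x\circ(y+z)=x\circ y+x\circ z$. *)

theory Defs
  imports Main "HOL-Library.FuncSet"
begin

text \<open>Algebras of similarity type \<open>(+, \<cdot>, \<circ>, 0, 1)\<close>. Operations matter only on the carrier.\<close>

record 'a alg =
  acarrier :: "'a set"
  ajoin :: "'a \<Rightarrow> 'a \<Rightarrow> 'a"
  ameet :: "'a \<Rightarrow> 'a \<Rightarrow> 'a"
  acomp :: "'a \<Rightarrow> 'a \<Rightarrow> 'a"
  azero :: 'a
  aone :: 'a

definition algebra :: "'a alg \<Rightarrow> bool" where
  "algebra A \<longleftrightarrow>
     azero A \<in> acarrier A \<and> aone A \<in> acarrier A \<and>
     (\<forall>x\<in>acarrier A. \<forall>y\<in>acarrier A.
        ajoin A x y \<in> acarrier A \<and> ameet A x y \<in> acarrier A \<and> acomp A x y \<in> acarrier A)"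

definition homomorphism :: "('a \<Rightarrow> 'b) \<Rightarrow> 'a alg \<Rightarrow> 'b alg \<Rightarrow> bool" where
  "homomorphism h A B \<longleftrightarrow>
     h ` acarrier A \<subseteq> acarrier B \<and>
     h (azero A) = azero B \<and> h (aone A) = aone B \<and>
     (\<forall>x\<in>acarrier A. \<forall>y\<in>acarrier A.
        h (ajoin A x y) = ajoin B (h x) (h y) \<and>
        h (ameet A x y) = ameet B (h x) (h y) \<and>
        h (acomp A x y) = acomp B (h x) (h y))"

definition subalgebra :: "'a alg \<Rightarrow> 'a alg \<Rightarrow> bool" where
  "subalgebra A B \<longleftrightarrow> algebra A \<and> homomorphism (\<lambda>x. x) A B"

definition product_alg :: "'i set \<Rightarrow> ('i \<Rightarrow> 'b alg) \<Rightarrow> ('i \<Rightarrow> 'b) alg" where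
  "product_alg I B =
     \<lparr> acarrier = (\<Pi>\<^sub>E i\<in>I. acarrier (B i)),
       ajoin = (\<lambda>f g. \<lambda>i\<in>I. ajoin (B i) (f i) (g i)),
       ameet = (\<lambda>f g. \<lambda>i\<in>I. ameet (B i) (f i) (g i)),
       acomp = (\<lambda>f g. \<lambda>i\<in>I. acomp (B i) (f i) (g i)),
       azero = (\<lambda>i\<in>I. azero (B i)),
       aone = (\<lambda>i\<in>I. aone (B i)) \<rparr>"

definition class_H :: "'b alg set \<Rightarrow> 'a alg set" where
  "class_H K = {A. algebra A \<and>
     (\<exists>B\<in>K. \<exists>h. homomorphism h B A \<and> h ` acarrier B = acarrier A)}"

definition class_S :: "'b alg set \<Rightarrow> 'b alg set" where
  "class_S K = {A. \<exists>B\<in>K. subalgebra A B}"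

definition class_P :: "'b alg set \<Rightarrow> ('i \<Rightarrow> 'b) alg set" where
  "class_P K = {product_alg I B | I B. \<forall>i\<in>I. B i \<in> K}"

text \<open>The variety generated by \<open>K\<close> is \<open>HSP(K)\<close>; here its members with carrier in \<open>'a\<close>.
  The type argument supplies the index sets of the products. It has to be large enough compared
  with \<open>'a\<close> (infinite, and at least as large as \<open>'a\<close>, suffices), since HOL cannot quantify over
  index sets of all types.\<close>

definition variety_generated :: "'i itself \<Rightarrow> 'b alg set \<Rightarrow> 'a alg set" where
  "variety_generated _ K = class_H (class_S (class_P K :: ('i \<Rightarrow> 'b) alg set))"

definition full_rel_alg :: "'u set \<Rightarrow> ('u \<times> 'u) set alg" where
  "full_rel_alg U =
     \<lparr> acarrier = Pow (U \<times> U), ajoin = (\<union>), ameet = (\<inter>), acomp = (O),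
       azero = {}, aone = Id_on U \<rparr>"

definition relation_algebra :: "('u \<times> 'u) set alg \<Rightarrow> bool" where
  "relation_algebra A \<longleftrightarrow> (\<exists>U. subalgebra A (full_rel_alg U))"

definition integral :: "'a alg \<Rightarrow> bool" where
  "integral A \<longleftrightarrow> aone A \<noteq> azero A \<and>
     (\<forall>x\<in>acarrier A. ameet A x (aone A) = x \<and> x \<noteq> azero A \<longrightarrow> x = aone A)"

definition Rel_integral :: "('u \<times> 'u) set alg set" where
  "Rel_integral = {A. relation_algebra A \<and> integral A}"

datatype trm =
    Var nat
  | Zero ("\<^bold>0")
  | One ("\<^bold>1")
  | Join trm trm (infixl "\<^bold>+" 65)
  | Meet trm trm (infixl "\<^bold>\<cdot>" 70)
  | Comp trm trm (infixl "\<^bold>\<circ>" 75)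

primrec eval :: "'a alg \<Rightarrow> (nat \<Rightarrow> 'a) \<Rightarrow> trm \<Rightarrow> 'a" where
  "eval A v (Var n) = v n"
| "eval A v \<^bold>0 = azero A"
| "eval A v \<^bold>1 = aone A"
| "eval A v (s \<^bold>+ t) = ajoin A (eval A v s) (eval A v t)"
| "eval A v (s \<^bold>\<cdot> t) = ameet A (eval A v s) (eval A v t)"
| "eval A v (s \<^bold>\<circ> t) = acomp A (eval A v s) (eval A v t)"

datatype equation = Eq trm trm (infix "\<^bold>=" 50)

primrec satisfies :: "'a alg \<Rightarrow> equation \<Rightarrow> bool" where
  "satisfies A (s \<^bold>= t) \<longleftrightarrow> (\<forall>v. range v \<subseteq> acarrier A \<longrightarrow> eval A v s = eval A v t)"

definition models :: "equation set \<Rightarrow> 'a alg set" where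
  "models E = {A. algebra A \<and> (\<forall>e\<in>E. satisfies A e)}"

abbreviation Leq :: "trm \<Rightarrow> trm \<Rightarrow> equation" (infix "\<^bold>\<le>" 50) where
  "s \<^bold>\<le> t \<equiv> s \<^bold>\<cdot> t \<^bold>= s"

definition Ax_distrib_lattice :: "equation set" where
  "Ax_distrib_lattice = (let x = Var 0; y = Var 1; z = Var 2 in
    { x \<^bold>+ x \<^bold>= x,
      x \<^bold>\<cdot> x \<^bold>= x,
      x \<^bold>+ y \<^bold>= y \<^bold>+ x,
      x \<^bold>\<cdot> y \<^bold>= y \<^bold>\<cdot> x,
      (x \<^bold>+ y) \<^bold>+ z \<^bold>= x \<^bold>+ (y \<^bold>+ z),
      (x \<^bold>\<cdot> y) \<^bold>\<cdot> z \<^bold>= x \<^bold>\<cdot> (y \<^bold>\<cdot> z),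
      x \<^bold>+ (x \<^bold>\<cdot> y) \<^bold>= x,
      x \<^bold>\<cdot> (x \<^bold>+ y) \<^bold>= x,
      x \<^bold>\<cdot> (y \<^bold>+ z) \<^bold>= (x \<^bold>\<cdot> y) \<^bold>+ (x \<^bold>\<cdot> z),
      x \<^bold>+ (y \<^bold>\<cdot> z) \<^bold>= (x \<^bold>+ y) \<^bold>\<cdot> (x \<^bold>+ z) })"

definition Ax_monoid :: "equation set" where
  "Ax_monoid = (let x = Var 0; y = Var 1; z = Var 2 in
    { (x \<^bold>\<circ> y) \<^bold>\<circ> z \<^bold>= x \<^bold>\<circ> (y \<^bold>\<circ> z),
      \<^bold>1 \<^bold>\<circ> x \<^bold>= x,
      x \<^bold>\<circ> \<^bold>1 \<^bold>= x })"

definition Ax_integral :: "equation set" where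
  "Ax_integral = Ax_distrib_lattice \<union> Ax_monoid \<union>
    (let x = Var 0; y = Var 1; z = Var 2; x' = Var 3; y' = Var 4 in
    { (x \<^bold>\<cdot> x') \<^bold>\<circ> (y \<^bold>\<cdot> y') \<^bold>\<le> x \<^bold>\<circ> y,
      \<^bold>0 \<^bold>= \<^bold>0 \<^bold>\<cdot> x,
      \<^bold>0 \<^bold>= \<^bold>0 \<^bold>\<circ> x,
      \<^bold>0 \<^bold>= x \<^bold>\<circ> \<^bold>0,
      (\<^bold>1 \<^bold>\<cdot> x) \<^bold>\<circ> (\<^bold>1 \<^bold>\<cdot> y) \<^bold>= \<^bold>1 \<^bold>\<cdot> x \<^bold>\<cdot> y,
      (\<^bold>1 \<^bold>\<cdot> x) \<^bold>\<circ> (y \<^bold>\<cdot> z) \<^bold>= ((\<^bold>1 \<^bold>\<cdot> x) \<^bold>\<circ> y) \<^bold>\<cdot> z,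
      (x \<^bold>\<cdot> y) \<^bold>\<circ> (\<^bold>1 \<^bold>\<cdot> z) \<^bold>= x \<^bold>\<cdot> (y \<^bold>\<circ> (\<^bold>1 \<^bold>\<cdot> z)),
      \<^bold>1 \<^bold>\<cdot> (x \<^bold>\<circ> y) \<^bold>= \<^bold>1 \<^bold>\<cdot> (y \<^bold>\<circ> x),
      (\<^bold>1 \<^bold>\<cdot> x) \<^bold>\<circ> y \<^bold>= y \<^bold>\<circ> (\<^bold>1 \<^bold>\<cdot> x),
      (x \<^bold>+ y) \<^bold>\<circ> z \<^bold>= (x \<^bold>\<circ> z) \<^bold>+ (y \<^bold>\<circ> z),
      x \<^bold>\<circ> (y \<^bold>+ z) \<^bold>= (x \<^bold>\<circ> y) \<^bold>+ (x \<^bold>\<circ> z) })"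

end

theory Submission
  imports Defs "HOL-Library.Countable_Set" "HOL-Library.Nat_Bijection"
begin

text \<open>
  Let \<open>s\<close> and \<open>t\<close> be terms with \<open>s \<le> t\<close> failing in a model \<open>A\<close> of the axioms. A maximal preorder
  that contains the order of \<open>A\<close>, is compatible with the operations and does not relate \<open>s\<close> to \<open>t\<close>
  makes \<open>1\<close> an atom: an element \<open>e \<le> 1\<close> is central and idempotent, so that it can be collapsed to
  \<open>1\<close> or to \<open>0\<close>, and one of the two keeps \<open>s\<close> and \<open>t\<close> apart.

  For such a preorder one builds a countable set of points whose pairs \<open>(p, q)\<close> carry filters
  \<open>L p q\<close> with \<open>L p p\<close> the filter of all elements above \<open>1\<close>. Whenever \<open>x \<circ> y \<in> L u v\<close>, a new point
  \<open>w\<close> is added with \<open>L p w\<close> generated by \<open>L p u \<circ> x\<close> and \<open>L w q\<close> generated by \<open>y \<circ> L v q\<close>; the axiom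
  \<open>1 \<cdot> (x \<circ> y) = 1 \<cdot> (y \<circ> x)\<close> is what makes this consistent at \<open>(w, w)\<close>. The relations
  \<open>{(p, q). c \<in> L p q}\<close> respect meet and composition, and every loop occurs at all points as soon
  as it occurs at one, so their finite unions together with the identity form an integral
  relation algebra. Joins are not preserved, but \<open>s\<close> is below a finite join of join-free elements,
  one of which is not below \<open>t\<close>, and this separates \<open>s\<close> from \<open>t\<close>.
\<close>

section \<open>Saturated networks of filters\<close>

text \<open>The preorder stands in for the order of a quotient algebra, while elements and
  operations stay those of the original algebra. \<open>cyclic\<close> makes it possible to add
  points to a network; \<open>one_atom\<close> and \<open>one_not_le_zero\<close> say that the
  identity is an atom of the quotient.\<close>

locale integral_preorder =
  fixes C :: "'a set"
    and le :: "'a \<Rightarrow> 'a \<Rightarrow> bool" (infix "\<sqsubseteq>" 50)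
    and meet :: "'a \<Rightarrow> 'a \<Rightarrow> 'a" (infixl "\<otimes>" 70)
    and comp :: "'a \<Rightarrow> 'a \<Rightarrow> 'a" (infixl "\<odot>" 75)
    and zero :: 'a
    and one :: 'a
  assumes zero_closed [simp]: "zero \<in> C"
    and one_closed [simp]: "one \<in> C"
    and meet_closed [simp]: "\<lbrakk>x \<in> C; y \<in> C\<rbrakk> \<Longrightarrow> x \<otimes> y \<in> C"
    and comp_closed [simp]: "\<lbrakk>x \<in> C; y \<in> C\<rbrakk> \<Longrightarrow> x \<odot> y \<in> C"
    and refl [simp]: "x \<in> C \<Longrightarrow> x \<sqsubseteq> x"
    and trans: "\<lbrakk>x \<sqsubseteq> y; y \<sqsubseteq> z; x \<in> C; y \<in> C; z \<in> C\<rbrakk> \<Longrightarrow> x \<sqsubseteq> z"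
    and meet_le1: "\<lbrakk>x \<in> C; y \<in> C\<rbrakk> \<Longrightarrow> x \<otimes> y \<sqsubseteq> x"
    and meet_le2: "\<lbrakk>x \<in> C; y \<in> C\<rbrakk> \<Longrightarrow> x \<otimes> y \<sqsubseteq> y"
    and meet_greatest: "\<lbrakk>z \<sqsubseteq> x; z \<sqsubseteq> y; x \<in> C; y \<in> C; z \<in> C\<rbrakk> \<Longrightarrow> z \<sqsubseteq> x \<otimes> y"
    and comp_mono: "\<lbrakk>x \<sqsubseteq> x'; y \<sqsubseteq> y'; x \<in> C; x' \<in> C; y \<in> C; y' \<in> C\<rbrakk>
        \<Longrightarrow> x \<odot> y \<sqsubseteq> x' \<odot> y'"
    and comp_assoc: "\<lbrakk>x \<in> C; y \<in> C; z \<in> C\<rbrakk> \<Longrightarrow> x \<odot> y \<odot> z = x \<odot> (y \<odot> z)"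
    and one_comp [simp]: "x \<in> C \<Longrightarrow> one \<odot> x = x"
    and comp_one [simp]: "x \<in> C \<Longrightarrow> x \<odot> one = x"
    and zero_le: "x \<in> C \<Longrightarrow> zero \<sqsubseteq> x"
    and zero_comp [simp]: "x \<in> C \<Longrightarrow> zero \<odot> x = zero"
    and comp_zero [simp]: "x \<in> C \<Longrightarrow> x \<odot> zero = zero"
    and cyclic: "\<lbrakk>one \<sqsubseteq> x \<odot> y; x \<in> C; y \<in> C\<rbrakk> \<Longrightarrow> one \<sqsubseteq> y \<odot> x"
    and one_atom: "x \<in> C \<Longrightarrow> one \<otimes> x \<sqsubseteq> zero \<or> one \<sqsubseteq> x"
    and one_not_le_zero: "\<not> one \<sqsubseteq> zero"
begin

section \<open>Filters and networks labelled by filters\<close>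

definition up :: "'a \<Rightarrow> 'a set" where
  "up x = {c \<in> C. x \<sqsubseteq> c}"

definition lfilter :: "'a set \<Rightarrow> bool" where
  "lfilter F \<longleftrightarrow> F \<subseteq> C \<and> zero \<notin> F \<and> (\<forall>x\<in>F. \<forall>y\<in>C. x \<sqsubseteq> y \<longrightarrow> y \<in> F) \<and>
     (\<forall>x\<in>F. \<forall>y\<in>F. x \<otimes> y \<in> F)"

text \<open>The label \<open>L p q\<close> collects the elements whose relation is to contain
  \<open>(p, q)\<close>. All loops have the same label, so that a relation contains either all loops
  or none; this is how the identity relation becomes an atom.\<close>

definition network :: "'p set \<Rightarrow> ('p \<Rightarrow> 'p \<Rightarrow> 'a set) \<Rightarrow> bool" where
  "network V L \<longleftrightarrow>
     (\<forall>p\<in>V. \<forall>q\<in>V. lfilter (L p q)) \<and> (\<forall>p\<in>V. L p p = up one) \<and>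
     (\<forall>p\<in>V. \<forall>q\<in>V. \<forall>r\<in>V. \<forall>x\<in>L p q. \<forall>y\<in>L q r. x \<odot> y \<in> L p r)"

lemma lfilter_empty [simp]: "lfilter {}"
  by (simp add: lfilter_def)

lemma lfilter_up: "\<lbrakk>x \<in> C; \<not> x \<sqsubseteq> zero\<rbrakk> \<Longrightarrow> lfilter (up x)"
  unfolding lfilter_def up_def using trans meet_greatest by auto

lemma lfilter_up_one [simp]: "lfilter (up one)"
  by (simp add: lfilter_up one_not_le_zero)

lemma lfilter_subset: "lfilter F \<Longrightarrow> x \<in> F \<Longrightarrow> x \<in> C"
  by (auto simp: lfilter_def)

lemma lfilter_upward: "\<lbrakk>lfilter F; x \<in> F; x \<sqsubseteq> y; y \<in> C\<rbrakk> \<Longrightarrow> y \<in> F"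
  by (auto simp: lfilter_def)

lemma lfilter_meet: "\<lbrakk>lfilter F; x \<in> C; y \<in> C\<rbrakk> \<Longrightarrow> x \<otimes> y \<in> F \<longleftrightarrow> x \<in> F \<and> y \<in> F"
  unfolding lfilter_def using meet_le1 meet_le2 by (metis meet_closed)

lemma lfilter_zero: "lfilter F \<Longrightarrow> zero \<notin> F"
  by (auto simp: lfilter_def)

text \<open>A monotone map sends a filter to a filter base, since \<open>f (z1 \<otimes> z2)\<close>
  lies below \<open>f z1\<close> and \<open>f z2\<close>. It is applied to the translations
  \<open>z \<odot> x\<close> and \<open>y \<odot> z\<close>.\<close>

lemma lfilter_image_up:
  assumes F: "lfilter F"
    and f_closed: "\<And>z. z \<in> C \<Longrightarrow> f z \<in> C"
    and f_mono: "\<And>z z'. \<lbrakk>z \<sqsubseteq> z'; z \<in> C; z' \<in> C\<rbrakk> \<Longrightarrow> f z \<sqsubseteq> f z'"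
    and f_nonzero: "\<And>z. z \<in> F \<Longrightarrow> \<not> f z \<sqsubseteq> zero"
  shows "lfilter (\<Union>z\<in>F. up (f z))"
  unfolding lfilter_def
proof (intro conjI ballI impI)
  show "(\<Union>z\<in>F. up (f z)) \<subseteq> C" "zero \<notin> (\<Union>z\<in>F. up (f z))"
    using f_nonzero by (auto simp: up_def)
next
  fix x y assume "x \<in> (\<Union>z\<in>F. up (f z))" "y \<in> C" "x \<sqsubseteq> y"
  then show "y \<in> (\<Union>z\<in>F. up (f z))"
    using F lfilter_subset f_closed trans by (auto simp: up_def) blast
next
  fix x y assume "x \<in> (\<Union>z\<in>F. up (f z))" "y \<in> (\<Union>z\<in>F. up (f z))"
  then obtain z1 z2 where z: "z1 \<in> F" "z2 \<in> F" "x \<in> C" "y \<in> C" "f z1 \<sqsubseteq> x" "f z2 \<sqsubseteq> y"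
    by (auto simp: up_def)
  then have c: "z1 \<in> C" "z2 \<in> C"
    using F lfilter_subset by auto
  then have m: "z1 \<otimes> z2 \<in> F"
    using F lfilter_meet z by blast
  have "f (z1 \<otimes> z2) \<sqsubseteq> x" "f (z1 \<otimes> z2) \<sqsubseteq> y"
    using f_mono[of "z1 \<otimes> z2" z1] f_mono[of "z1 \<otimes> z2" z2] c z trans meet_le1 meet_le2
      f_closed meet_closed by metis+
  then show "x \<otimes> y \<in> (\<Union>z\<in>F. up (f z))"
    using m z c meet_greatest f_closed by (auto simp: up_def intro!: bexI[of _ "z1 \<otimes> z2"])
qed

lemma network_lfilter: "\<lbrakk>network V L; p \<in> V; q \<in> V\<rbrakk> \<Longrightarrow> lfilter (L p q)"
  by (simp add: network_def)

lemma network_loop: "\<lbrakk>network V L; p \<in> V\<rbrakk> \<Longrightarrow> L p p = up one"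
  by (simp add: network_def)

lemma network_comp:
  "\<lbrakk>network V L; x \<in> L p q; y \<in> L q r; p \<in> V; q \<in> V; r \<in> V\<rbrakk> \<Longrightarrow> x \<odot> y \<in> L p r"
  by (auto simp: network_def)

section \<open>Extension of a network by one point\<close>

lemma up_one_comp:
  "\<lbrakk>lfilter F; x \<in> up one; y \<in> F\<rbrakk> \<Longrightarrow> x \<odot> y \<in> F"
  using comp_mono[of one x y y] lfilter_upward[of F y "x \<odot> y"] lfilter_subset[of F y]
  by (auto simp: up_def)

lemma comp_up_one:
  "\<lbrakk>lfilter F; x \<in> up one; y \<in> F\<rbrakk> \<Longrightarrow> y \<odot> x \<in> F"
  using comp_mono[of y y one x] lfilter_upward[of F y "y \<odot> x"] lfilter_subset[of F y]
  by (auto simp: up_def)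

text \<open>Each of the four composition hypotheses serves one shape of triangle through
  \<open>w\<close>: ending in it, starting from it, passing through it, and returning to it. In the
  triangles where \<open>w\<close> follows itself, composition with an element above
  \<open>one\<close> stays inside the filter.\<close>

lemma network_insert:
  assumes N: "network V L" and w: "w \<notin> V"
    and In: "\<And>p. p \<in> V \<Longrightarrow> lfilter (In p)" and Out: "\<And>p. p \<in> V \<Longrightarrow> lfilter (Out p)"
    and LIn: "\<And>p q x y. \<lbrakk>p \<in> V; q \<in> V; x \<in> L p q; y \<in> In q\<rbrakk> \<Longrightarrow> x \<odot> y \<in> In p"
    and OutL: "\<And>p q x y. \<lbrakk>p \<in> V; q \<in> V; x \<in> Out p; y \<in> L p q\<rbrakk> \<Longrightarrow> x \<odot> y \<in> Out q"
    and InOut: "\<And>p q x y. \<lbrakk>p \<in> V; q \<in> V; x \<in> In p; y \<in> Out q\<rbrakk> \<Longrightarrow> x \<odot> y \<in> L p q"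
    and OutIn: "\<And>p x y. \<lbrakk>p \<in> V; x \<in> Out p; y \<in> In p\<rbrakk> \<Longrightarrow> x \<odot> y \<in> up one"
  shows "network (insert w V)
    (\<lambda>p q. if p = w then if q = w then up one else Out q else if q = w then In p else L p q)"
    (is "network _ ?M")
  unfolding network_def
proof (intro conjI ballI)
  fix p q assume "p \<in> insert w V" "q \<in> insert w V"
  then show "lfilter (?M p q)"
    using In Out network_lfilter[OF N] by auto
next
  fix p assume "p \<in> insert w V"
  then show "?M p p = up one"
    using network_loop[OF N] by auto
next
  fix p q r x y
  assume pqr: "p \<in> insert w V" "q \<in> insert w V" "r \<in> insert w V"
    and x: "x \<in> ?M p q" and y: "y \<in> ?M q r"
  show "x \<odot> y \<in> ?M p r"
  proof (cases "q = w")
    case True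
    show ?thesis
    proof (cases "p = w \<or> r = w")
      case True
      then show ?thesis
        using \<open>q = w\<close> x y pqr In Out up_one_comp comp_up_one by (auto split: if_splits)
    next
      case False
      then show ?thesis
        using \<open>q = w\<close> x y pqr InOut by auto
    qed
  next
    case False
    then show ?thesis
      using x y pqr LIn OutL OutIn network_comp[OF N] by (auto split: if_splits)
  qed
qed

text \<open>The labels of \<open>w\<close> are the least ones that put \<open>x\<close> on
  \<open>(u, w)\<close> and \<open>y\<close> on \<open>(w, v)\<close>. Because
  \<open>x \<odot> y\<close> already lies on \<open>(u, v)\<close>, the conditions on triangles
  through \<open>w\<close> reduce to compositions in the old network.\<close>

lemma network_witness:
  assumes N: "network V L" and w: "w \<notin> V" and uv: "u \<in> V" "v \<in> V"
    and xy: "x \<in> C" "y \<in> C" "x \<odot> y \<in> L u v"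
  shows "\<exists>L'. network (insert w V) L' \<and> (\<forall>p\<in>V. \<forall>q\<in>V. L' p q = L p q) \<and>
    x \<in> L' u w \<and> y \<in> L' w v"
proof -
  define In where "In p = (\<Union>z\<in>L p u. up (z \<odot> x))" for p
  define Out where "Out q = (\<Union>z\<in>L v q. up (y \<odot> z))" for q
  note closed = lfilter_subset[OF network_lfilter[OF N]]
  note upward = lfilter_upward[OF network_lfilter[OF N]]
  have lf1: "lfilter (In p)" if p: "p \<in> V" for p
    unfolding In_def
  proof (rule lfilter_image_up)
    fix z assume z: "z \<in> L p u"
    then have "z \<in> C" using closed p uv by blast
    show "\<not> z \<odot> x \<sqsubseteq> zero"
    proof
      \<comment> \<open>Composing with \<open>y\<close> would put \<open>zero\<close> on
        \<open>(p, v)\<close>.\<close>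
      assume "z \<odot> x \<sqsubseteq> zero"
      then have "z \<odot> (x \<odot> y) \<sqsubseteq> zero"
        using comp_mono[of "z \<odot> x" zero y y] \<open>z \<in> C\<close> xy comp_assoc[of z x y] by simp
      moreover have "z \<odot> (x \<odot> y) \<in> L p v"
        using network_comp[OF N z xy(3)] p uv by blast
      ultimately show False
        using upward[of p v] lfilter_zero[OF network_lfilter[OF N, of p v]] p uv by auto
    qed
  qed (use N p uv xy comp_mono network_lfilter in auto)
  have lf2: "lfilter (Out p)" if p: "p \<in> V" for p
    unfolding Out_def
  proof (rule lfilter_image_up)
    fix z assume z: "z \<in> L v p"
    then have "z \<in> C" using closed p uv by blast
    show "\<not> y \<odot> z \<sqsubseteq> zero"
    proof
      assume "y \<odot> z \<sqsubseteq> zero"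
      then have "x \<odot> y \<odot> z \<sqsubseteq> zero"
        using comp_mono[of x x "y \<odot> z" zero] \<open>z \<in> C\<close> xy comp_assoc[of x y z] by simp
      moreover have "x \<odot> y \<odot> z \<in> L u p"
        using network_comp[OF N xy(3) z] p uv by blast
      ultimately show False
        using upward[of u p] lfilter_zero[OF network_lfilter[OF N, of u p]] p uv by auto
    qed
  qed (use N p uv xy comp_mono network_lfilter in auto)
  define M where "M p q = (if p = w then if q = w then up one else Out q
      else if q = w then In p else L p q)" for p q
  have "network (insert w V) M"
    unfolding M_def
  proof (rule network_insert[OF N w lf1 lf2])
    fix p q c d assume pq: "p \<in> V" "q \<in> V" and c: "c \<in> L p q" and d: "d \<in> In q"
    then obtain z where z: "z \<in> L q u" "z \<odot> x \<sqsubseteq> d" "d \<in> C" "z \<in> C" "c \<in> C"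
      using closed[of q u] closed[of p q] uv by (auto simp: In_def up_def)
    then have "c \<odot> z \<odot> x \<sqsubseteq> c \<odot> d"
      using comp_mono[of c c "z \<odot> x" d] xy comp_assoc[of c z x] by simp
    then show "c \<odot> d \<in> In p"
      using network_comp[OF N c z(1)] pq uv z by (auto simp: In_def up_def)
  next
    fix p q c d assume pq: "p \<in> V" "q \<in> V" and c: "c \<in> Out p" and d: "d \<in> L p q"
    then obtain z where z: "z \<in> L v p" "y \<odot> z \<sqsubseteq> c" "d \<in> C" "z \<in> C" "c \<in> C"
      using closed[of v p] closed[of p q] uv by (auto simp: Out_def up_def)
    then have "y \<odot> (z \<odot> d) \<sqsubseteq> c \<odot> d"
      using comp_mono[of "y \<odot> z" c d d] xy comp_assoc[of y z d] by simp
    then show "c \<odot> d \<in> Out q"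
      using network_comp[OF N z(1) d] pq uv z by (auto simp: Out_def up_def)
  next
    fix p q c d assume pq: "p \<in> V" "q \<in> V" and c: "c \<in> In p" and d: "d \<in> Out q"
    then obtain z z' where z: "z \<in> L p u" "z \<odot> x \<sqsubseteq> c" "z' \<in> L v q" "y \<odot> z' \<sqsubseteq> d"
        "c \<in> C" "d \<in> C" "z \<in> C" "z' \<in> C"
      using closed[of p u] closed[of v q] uv by (auto simp: In_def Out_def up_def)
    then have "z \<odot> (x \<odot> y) \<odot> z' \<sqsubseteq> c \<odot> d"
      using comp_mono[of "z \<odot> x" c "y \<odot> z'" d] xy by (simp add: comp_assoc)
    moreover have "z \<odot> (x \<odot> y) \<odot> z' \<in> L p q"
      using network_comp[OF N network_comp[OF N z(1) xy(3)] z(3)] pq uv by blast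
    ultimately show "c \<odot> d \<in> L p q"
      using upward[of p q] pq z by auto
  next
    fix p c d assume p: "p \<in> V" and c: "c \<in> Out p" and d: "d \<in> In p"
    then obtain z z' where z: "z \<in> L p u" "z \<odot> x \<sqsubseteq> d" "z' \<in> L v p" "y \<odot> z' \<sqsubseteq> c"
        "c \<in> C" "d \<in> C" "z \<in> C" "z' \<in> C"
      using closed[of p u] closed[of v p] uv by (auto simp: In_def Out_def up_def)
    \<comment> \<open>The closed walk \<open>v\<close>, \<open>p\<close>, \<open>u\<close>,
      \<open>v\<close> gives an element of the label of an old loop. Cyclicity turns its final
      factor \<open>y\<close> into the first, which is the product needed at the loop of
      \<open>w\<close>.\<close>
    have "z' \<odot> z \<odot> (x \<odot> y) \<in> L v v"
      using network_comp[OF N network_comp[OF N z(3) z(1)] xy(3)] p uv by blast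
    then have "one \<sqsubseteq> (z' \<odot> z \<odot> x) \<odot> y"
      using network_loop[OF N uv(2)] z xy by (simp add: up_def comp_assoc)
    then have "one \<sqsubseteq> y \<odot> (z' \<odot> z \<odot> x)"
      using cyclic z xy by simp
    moreover have "y \<odot> (z' \<odot> z \<odot> x) \<sqsubseteq> c \<odot> d"
      using comp_mono[of "y \<odot> z'" c "z \<odot> x" d] xy z by (simp add: comp_assoc)
    ultimately show "c \<odot> d \<in> up one"
      using z xy trans[of one "y \<odot> (z' \<odot> z \<odot> x)" "c \<odot> d"] by (simp add: up_def)
  qed auto
  \<comment> \<open>As a member of both loops, \<open>one\<close> shows that
    \<open>x = one \<odot> x\<close> and \<open>y = y \<odot> one\<close> belong to the new
    labels.\<close>
  moreover have "one \<in> L u u" "one \<in> L v v"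
    using network_loop[OF N] uv by (auto simp: up_def)
  then have "x \<in> M u w" "y \<in> M w v"
    using w uv xy by (auto simp: M_def In_def Out_def up_def intro!: bexI[of _ one])
  moreover have "\<forall>p\<in>V. \<forall>q\<in>V. M p q = L p q"
    using w by (auto simp: M_def)
  ultimately show ?thesis by blast
qed

text \<open>A stage whose request does not apply still adds its point, so that the points of each
  stage are fixed in advance.\<close>

lemma network_isolated:
  assumes N: "network V L" and w: "w \<notin> V"
  shows "\<exists>L'. network (insert w V) L' \<and> (\<forall>p\<in>V. \<forall>q\<in>V. L' p q = L p q)"
  using network_insert[OF N w, of "\<lambda>_. {}" "\<lambda>_. {}"] w
  by (intro exI[of _ "\<lambda>p q. if p = w then if q = w then up one else {}
      else if q = w then {} else L p q"]) auto

section \<open>The countable saturated network\<close>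

text \<open>Every edge leads from a copy tagged \<open>False\<close> to a copy tagged
  \<open>True\<close>, so two edges between distinct points never compose and only loops need
  checking. An element below \<open>zero\<close> generates no proper filter; its two points stay
  unrelated.\<close>

lemma network_disjoint_edges:
  "network (Inl ` (C \<times> UNIV)) (\<lambda>p q. if p = q then up one
     else case (p, q) of (Inl (c, False), Inl (d, True)) \<Rightarrow>
       if c = d \<and> \<not> c \<sqsubseteq> zero then up c else {} | _ \<Rightarrow> {})"
  (is "network ?V ?L")
  unfolding network_def
proof (intro conjI ballI)
  fix p q assume "p \<in> ?V" "q \<in> ?V"
  then show "lfilter (?L p q)"
    by (auto simp: lfilter_up split: bool.splits if_splits)
next
  fix p q r x y assume V: "p \<in> ?V" "q \<in> ?V" "r \<in> ?V" and x: "x \<in> ?L p q" and y: "y \<in> ?L q r"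
  have lf: "lfilter (?L p r)"
    using V by (auto simp: lfilter_up split: bool.splits if_splits)
  consider "p = q" | "q = r" | "p \<noteq> q" "q \<noteq> r" by blast
  then show "x \<odot> y \<in> ?L p r"
  proof cases
    case 1
    have "x \<in> up one" "y \<in> ?L p r"
      using x y unfolding 1 by simp_all
    then show ?thesis
      by (rule up_one_comp[OF lf])
  next
    case 2
    have "y \<in> up one" "x \<in> ?L p r"
      using x y unfolding 2 by simp_all
    then show ?thesis
      by (rule comp_up_one[OF lf])
  next
    case 3
    then show ?thesis
      using x y V by (auto split: bool.splits if_splits)
  qed
qed simp

text \<open>One-point extensions are repeated along a list of all requests
  \<open>(u, v, x, y)\<close>, and the union is taken. Labels of old pairs never change, which
  preserves the initial edges and makes the limit a network.\<close>

theorem saturated_network: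
  assumes "countable C"
  obtains V :: "('a \<times> bool + nat) set" and L where
    "countable V" "network V L" "V \<noteq> {}"
    "\<And>u v x y. \<lbrakk>u \<in> V; v \<in> V; x \<in> C; y \<in> C; x \<odot> y \<in> L u v\<rbrakk>
        \<Longrightarrow> \<exists>w\<in>V. x \<in> L u w \<and> y \<in> L w v"
    "\<And>c. \<lbrakk>c \<in> C; \<not> c \<sqsubseteq> zero\<rbrakk> \<Longrightarrow> \<exists>p\<in>V. \<exists>q\<in>V. L p q = up c"
proof -
  define V0 :: "('a \<times> bool + nat) set" where "V0 = Inl ` (C \<times> UNIV)"
  define V :: "nat \<Rightarrow> ('a \<times> bool + nat) set" where "V n = V0 \<union> Inr ` {..<n}" for n
  define W where "W = V0 \<union> range Inr"
  have V_Suc: "V (Suc n) = insert (Inr n) (V n)" and new: "Inr n \<notin> V n" for n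
    by (auto simp: V_def V0_def lessThan_Suc)
  have W_V: "\<exists>n. p \<in> V n" if "p \<in> W" for p
    using that by (auto simp: W_def V_def)
  have V_mono: "V m \<subseteq> V n" if "m \<le> n" for m n
    using that by (auto simp: V_def)
  have "countable W"
    using assms by (auto simp: W_def V0_def)
  define Q where "Q = W \<times> W \<times> C \<times> C"
  have "countable Q" "Q \<noteq> {}"
    using \<open>countable W\<close> assms one_closed by (auto simp: Q_def W_def simp del: one_closed)
  \<comment> \<open>Ignoring the first component of \<open>prod_decode n\<close> lists every request
    infinitely often: one that comes before its points exist returns later.\<close>
  define req where "req n = from_nat_into Q (snd (prod_decode n))" for n
  define P where "P n L \<longleftrightarrow> network (V n) L \<and> (\<forall>c\<in>C. \<not> c \<sqsubseteq> zero \<longrightarrow>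
      L (Inl (c, False)) (Inl (c, True)) = up c)" for n L
  define R where "R n L L' \<longleftrightarrow> (\<forall>p\<in>V n. \<forall>q\<in>V n. L' p q = L p q) \<and>
      (case req n of (u, v, x, y) \<Rightarrow> u \<in> V n \<longrightarrow> v \<in> V n \<longrightarrow> x \<odot> y \<in> L u v \<longrightarrow>
        x \<in> L' u (Inr n) \<and> y \<in> L' (Inr n) v)" for n and L L' :: "_ \<Rightarrow> _ \<Rightarrow> 'a set"
  have "\<exists>f. \<forall>n. P n (f n) \<and> R n (f n) (f (Suc n))"
  proof (rule dependent_nat_choice)
    have "V 0 = Inl ` (C \<times> UNIV)"
      by (simp add: V_def V0_def)
    then show "\<exists>L. P 0 L"
      using network_disjoint_edges unfolding P_def
      by (intro exI[of _ "\<lambda>p q. if p = q then up one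
         else case (p, q) of (Inl (c, False), Inl (d, True)) \<Rightarrow>
         if c = d \<and> \<not> c \<sqsubseteq> zero then up c else {} | _ \<Rightarrow> {}"]) simp
  next
    fix L n assume "P n L"
    then have N: "network (V n) L"
      by (simp add: P_def)
    obtain u v x y where r: "req n = (u, v, x, y)"
      by (metis prod_cases4)
    have "req n \<in> Q"
      unfolding req_def using \<open>Q \<noteq> {}\<close> by (rule from_nat_into)
    then have xy: "x \<in> C" "y \<in> C"
      by (auto simp: r Q_def)
    obtain L' where "network (V (Suc n)) L'" "R n L L'"
    proof (cases "u \<in> V n \<and> v \<in> V n \<and> x \<odot> y \<in> L u v")
      case True
      then show ?thesis
        using network_witness[OF N new, of u v x y] xy that r
        unfolding V_Suc R_def by auto
    next
      case False
      then show ?thesis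
        using network_isolated[OF N new] that r unfolding V_Suc R_def by auto
    qed
    moreover have "Inl (c, b) \<in> V n" if "c \<in> C" for c b
      using that by (auto simp: V_def V0_def)
    ultimately have "P (Suc n) L'"
      using \<open>P n L\<close> by (auto simp: P_def R_def)
    then show "\<exists>L'. P (Suc n) L' \<and> R n L L'"
      using \<open>R n L L'\<close> by blast
  qed
  then obtain f where fP: "\<And>n. P n (f n)" and fR: "\<And>n. R n (f n) (f (Suc n))"
    by blast
  have stable: "f n p q = f m p q" if "p \<in> V m" "q \<in> V m" "m \<le> n" for m n p q
    using \<open>m \<le> n\<close>
  proof (induction n rule: dec_induct)
    case (step k)
    then have "p \<in> V k" "q \<in> V k"
      using V_mono that by blast+
    then show ?case
      using fR[of k] step.IH by (auto simp: R_def)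
  qed simp
  define st where "st p = (LEAST n. p \<in> V n)" for p
  have st: "p \<in> V n" if "p \<in> W" "st p \<le> n" for p n
    using W_V[OF that(1)] V_mono[OF that(2)] LeastI_ex[of "\<lambda>n. p \<in> V n"] by (auto simp: st_def)
  \<comment> \<open>This is the first stage that contains both points; by \<open>stable\<close>
    every later stage gives the same label.\<close>
  define L where "L p q = f (max (st p) (st q)) p q" for p q
  have L: "L p q = f n p q" if "p \<in> W" "q \<in> W" "st p \<le> n" "st q \<le> n" for p q n
    unfolding L_def using stable[of p "max (st p) (st q)" q n] st that by simp
  have "network W L"
    unfolding network_def
  proof (intro conjI ballI)
    fix p q assume "p \<in> W" "q \<in> W"
    then show "lfilter (L p q)"
      using L[of p q "max (st p) (st q)"] fP[of "max (st p) (st q)"] st network_lfilter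
      unfolding P_def by (metis max.cobounded1 max.cobounded2)
  next
    fix p assume "p \<in> W"
    then show "L p p = up one"
      using L[of p p "st p"] fP[of "st p"] st network_loop unfolding P_def by (metis order_refl)
  next
    fix p q r x y assume W: "p \<in> W" "q \<in> W" "r \<in> W" and xy: "x \<in> L p q" "y \<in> L q r"
    define n where "n = max (st p) (max (st q) (st r))"
    have n: "st p \<le> n" "st q \<le> n" "st r \<le> n"
      by (auto simp: n_def)
    have "network (V n) (f n)"
      using fP by (simp add: P_def)
    then have "x \<odot> y \<in> f n p r"
      using network_comp[of "V n" "f n" x p q y r] xy L n W st by auto
    then show "x \<odot> y \<in> L p r"
      using L n W by auto
  qed
  moreover have "\<exists>w\<in>W. x \<in> L u w \<and> y \<in> L w v"
    if uv: "u \<in> W" "v \<in> W" and xy: "x \<in> C" "y \<in> C" "x \<odot> y \<in> L u v" for u v x y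
  proof -
    have "(u, v, x, y) \<in> Q"
      using that by (simp add: Q_def)
    then obtain k where k: "from_nat_into Q k = (u, v, x, y)"
      using from_nat_into_surj \<open>countable Q\<close> by metis
    \<comment> \<open>The code of a pair is at least its first component, so both points are present
      at stage \<open>n\<close>.\<close>
    define n where "n = prod_encode (max (st u) (st v), k)"
    have n: "st u \<le> n" "st v \<le> n"
      using le_prod_encode_1[of "max (st u) (st v)" k] by (auto simp: n_def)
    have "req n = (u, v, x, y)"
      by (simp add: req_def n_def k)
    then have "x \<in> f (Suc n) u (Inr n) \<and> y \<in> f (Suc n) (Inr n) v"
      using fR[of n] uv xy st L n by (auto simp: R_def)
    moreover have "Inr n \<in> W" "st (Inr n) \<le> Suc n"
      unfolding st_def by (auto simp: W_def V_def intro!: Least_le)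
    ultimately show ?thesis
      using L uv n by (metis le_SucI)
  qed
  moreover have "\<exists>p\<in>W. \<exists>q\<in>W. L p q = up c" if "c \<in> C" "\<not> c \<sqsubseteq> zero" for c
  proof -
    have *: "Inl (c, b) \<in> W" "st (Inl (c, b)) \<le> 0" for b
      using that unfolding st_def by (auto simp: W_def V_def V0_def intro!: Least_le)
    have "L (Inl (c, False)) (Inl (c, True)) = f 0 (Inl (c, False)) (Inl (c, True))"
      using L * by blast
    also have "\<dots> = up c"
      using fP[of 0] that by (simp add: P_def)
    finally show ?thesis
      using * by blast
  qed
  ultimately show ?thesis
    using that[of W L] \<open>countable W\<close> by (auto simp: W_def)
qed

end

section \<open>Separating terms in integral relation algebras\<close>

text \<open>Terms over an arbitrary set of variables: the free algebra that maps onto an uncountable \<open>A\<close>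
  needs more variables than \<^typ>\<open>trm\<close> provides.\<close>

datatype (vars: 'x) tm = TVar 'x | TZero | TOne | TJoin "'x tm" "'x tm" | TMeet "'x tm" "'x tm"
  | TComp "'x tm" "'x tm"

primrec tval :: "'a alg \<Rightarrow> ('x \<Rightarrow> 'a) \<Rightarrow> 'x tm \<Rightarrow> 'a" where
  "tval A v (TVar x) = v x"
| "tval A v TZero = azero A"
| "tval A v TOne = aone A"
| "tval A v (TJoin s t) = ajoin A (tval A v s) (tval A v t)"
| "tval A v (TMeet s t) = ameet A (tval A v s) (tval A v t)"
| "tval A v (TComp s t) = acomp A (tval A v s) (tval A v t)"

section \<open>Finite unions of relations\<close>

inductive_set fin_unions :: "'a set set \<Rightarrow> 'a set set" for G where
  empty: "{} \<in> fin_unions G"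
| base: "X \<in> G \<Longrightarrow> X \<in> fin_unions G"
| union: "\<lbrakk>X \<in> fin_unions G; Y \<in> fin_unions G\<rbrakk> \<Longrightarrow> X \<union> Y \<in> fin_unions G"

text \<open>Since \<open>f\<close> distributes over unions in both arguments, a double induction
  reduces the claim to generators. It serves for intersection and for relational
  composition.\<close>

lemma fin_unions_additive:
  assumes X: "X \<in> fin_unions G" and Y: "Y \<in> fin_unions G"
    and base: "\<And>X Y. \<lbrakk>X \<in> G; Y \<in> G\<rbrakk> \<Longrightarrow> f X Y \<in> fin_unions G"
    and f: "\<And>X. f X {} = {}" "\<And>X. f {} X = {}"
      "\<And>X Y Z. f X (Y \<union> Z) = f X Y \<union> f X Z" "\<And>X Y Z. f (Y \<union> Z) X = f Y X \<union> f Z X"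
  shows "f X Y \<in> fin_unions G"
  using X
proof induction
  case (base X)
  from Y show ?case
    by induction (use assms(3) base f in \<open>auto intro: fin_unions.intros\<close>)
qed (auto simp: f intro: fin_unions.intros)

section \<open>Joins and finite covers\<close>

locale integral_alg_preorder =
  integral_preorder C le "ameet A" "acomp A" "azero A" "aone A"
  for A :: "'a alg" and C and le (infix "\<sqsubseteq>" 50) +
  assumes join_closed [simp]: "\<lbrakk>x \<in> C; y \<in> C\<rbrakk> \<Longrightarrow> ajoin A x y \<in> C"
    and le_join1: "\<lbrakk>x \<in> C; y \<in> C\<rbrakk> \<Longrightarrow> x \<sqsubseteq> ajoin A x y"
    and le_join2: "\<lbrakk>x \<in> C; y \<in> C\<rbrakk> \<Longrightarrow> y \<sqsubseteq> ajoin A x y"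
    and join_least: "\<lbrakk>x \<sqsubseteq> z; y \<sqsubseteq> z; x \<in> C; y \<in> C; z \<in> C\<rbrakk> \<Longrightarrow> ajoin A x y \<sqsubseteq> z"
    and meet_join: "\<lbrakk>x \<in> C; y \<in> C; z \<in> C\<rbrakk> \<Longrightarrow>
        ameet A x (ajoin A y z) = ajoin A (ameet A x y) (ameet A x z)"
    and join_meet: "\<lbrakk>x \<in> C; y \<in> C; z \<in> C\<rbrakk> \<Longrightarrow>
        ameet A (ajoin A y z) x = ajoin A (ameet A y x) (ameet A z x)"
    and comp_join: "\<lbrakk>x \<in> C; y \<in> C; z \<in> C\<rbrakk> \<Longrightarrow>
        acomp A x (ajoin A y z) = ajoin A (acomp A x y) (acomp A x z)"
    and join_comp: "\<lbrakk>x \<in> C; y \<in> C; z \<in> C\<rbrakk> \<Longrightarrow>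
        acomp A (ajoin A y z) x = ajoin A (acomp A y x) (acomp A z x)"
begin

text \<open>This says that \<open>a\<close> lies below a join of finitely many elements of
  \<open>S\<close>, with \<open>azero A\<close> as the empty join; the inductive form avoids
  iterated joins over finite sets.\<close>

inductive covered :: "'a set \<Rightarrow> 'a \<Rightarrow> bool" for S where
  zero: "\<lbrakk>a \<sqsubseteq> azero A; a \<in> C\<rbrakk> \<Longrightarrow> covered S a"
| elem: "\<lbrakk>c \<in> S; c \<in> C; a \<sqsubseteq> c; a \<in> C\<rbrakk> \<Longrightarrow> covered S a"
| join: "\<lbrakk>covered S a; covered S b; e \<sqsubseteq> ajoin A a b; e \<in> C\<rbrakk> \<Longrightarrow> covered S e"

lemma covered_closed: "covered S a \<Longrightarrow> a \<in> C"
  by (induction rule: covered.induct) auto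

lemma covered_le: "\<lbrakk>covered S a; b \<sqsubseteq> a; b \<in> C\<rbrakk> \<Longrightarrow> covered S b"
proof (induction arbitrary: b rule: covered.induct)
  case (zero a)
  then show ?case by (meson covered.zero trans zero_closed)
next
  case (elem c a)
  then show ?case by (meson covered.elem trans)
next
  case (join a b e)
  then show ?case by (meson covered.join covered_closed trans join_closed)
qed

lemma covered_mono: "\<lbrakk>covered S a; S \<subseteq> T\<rbrakk> \<Longrightarrow> covered T a"
  by (induction rule: covered.induct) (auto intro: covered.intros)

text \<open>Used in contraposed form: if a covered element is not below \<open>b\<close>, then some
  member of \<open>S\<close> is not below \<open>b\<close>.\<close>

lemma covered_least:
  "\<lbrakk>covered S a; b \<in> C; \<And>c. c \<in> S \<Longrightarrow> c \<sqsubseteq> b\<rbrakk> \<Longrightarrow> a \<sqsubseteq> b"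
proof (induction rule: covered.induct)
  case (zero a)
  then show ?case by (meson zero_le trans zero_closed)
next
  case (elem c a)
  then show ?case by (meson trans)
next
  case (join a a' e)
  then show ?case by (meson covered_closed trans join_closed join_least)
qed

text \<open>Expanding \<open>f\<close> over two finite joins leaves only terms \<open>f c d\<close>
  for single members of \<open>S\<close> and \<open>T\<close>; the nested inductions carry this out
  one argument at a time.\<close>

lemma covered_additive:
  assumes a: "covered S a" and b: "covered T b"
    and base: "\<And>c d. \<lbrakk>c \<in> S; d \<in> T; c \<in> C; d \<in> C\<rbrakk> \<Longrightarrow> covered U (f c d)"
    and closed: "\<And>x y. \<lbrakk>x \<in> C; y \<in> C\<rbrakk> \<Longrightarrow> f x y \<in> C"
    and mono: "\<And>x x' y y'. \<lbrakk>x \<sqsubseteq> x'; y \<sqsubseteq> y'; x \<in> C; x' \<in> C; y \<in> C; y' \<in> C\<rbrakk>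
        \<Longrightarrow> f x y \<sqsubseteq> f x' y'"
    and zero1: "\<And>x. x \<in> C \<Longrightarrow> f (azero A) x \<sqsubseteq> azero A"
    and zero2: "\<And>x. x \<in> C \<Longrightarrow> f x (azero A) \<sqsubseteq> azero A"
    and join1: "\<And>x y z. \<lbrakk>x \<in> C; y \<in> C; z \<in> C\<rbrakk> \<Longrightarrow> f (ajoin A y z) x = ajoin A (f y x) (f z x)"
    and join2: "\<And>x y z. \<lbrakk>x \<in> C; y \<in> C; z \<in> C\<rbrakk> \<Longrightarrow> f x (ajoin A y z) = ajoin A (f x y) (f x z)"
  shows "covered U (f a b)"
  using a
proof induction
  case (zero a)
  have "b \<in> C" using covered_closed[OF b] .
  then have "f a b \<sqsubseteq> azero A"
    using mono[of a "azero A" b b] zero zero1[of b] trans[of "f a b" "f (azero A) b" "azero A"] closed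
    by simp
  then show ?case
    using closed zero \<open>b \<in> C\<close> by (auto intro: covered.zero)
next
  case (elem c a)
  from b have "covered U (f c b)"
  proof induction
    case (zero b)
    have "f c b \<sqsubseteq> azero A"
      using mono[of c c b "azero A"] zero elem zero2[of c] trans[of "f c b" "f c (azero A)" "azero A"]
        closed by simp
    then show ?case
      using closed zero elem by (auto intro: covered.zero)
  next
    case (elem d b)
    show ?case
      by (rule covered_le[OF base[of c d]]) (use elem \<open>c \<in> S\<close> \<open>c \<in> C\<close> mono closed in auto)
  next
    case (join b b' e)
    note bc = covered_closed[OF join(1)] covered_closed[OF join(2)]
    show ?case
    proof (rule covered.join[OF join.IH])
      show "f c e \<sqsubseteq> ajoin A (f c b) (f c b')"
        using mono[of c c e "ajoin A b b'"] join bc \<open>c \<in> C\<close> by (simp add: join2)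
    qed (use closed join \<open>c \<in> C\<close> in auto)
  qed
  then show ?case
    by (rule covered_le) (use elem mono closed covered_closed[OF b] in auto)
next
  case (join a a' e)
  note ac = covered_closed[OF join(1)] covered_closed[OF join(2)] covered_closed[OF b]
  show ?case
  proof (rule covered.join[OF join.IH])
    show "f e b \<sqsubseteq> ajoin A (f a b) (f a' b)"
      using mono[of e "ajoin A a a'" b b] join ac by (simp add: join1)
  qed (use closed join ac in auto)
qed

section \<open>Representation by relations on the points of a network\<close>

lemma tval_closed: "vars t \<subseteq> C \<Longrightarrow> tval A (\<lambda>x. x) t \<in> C"
  by (induction t) auto

lemma meet_mono:
  assumes "x \<sqsubseteq> x'" "y \<sqsubseteq> y'" "x \<in> C" "x' \<in> C" "y \<in> C" "y' \<in> C"
  shows "ameet A x y \<sqsubseteq> ameet A x' y'"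
  using assms meet_greatest[of "ameet A x y" x' y'] meet_le1[of x y] meet_le2[of x y]
    trans[of "ameet A x y" x x'] trans[of "ameet A x y" y y'] by auto

text \<open>A term is compared from two sides with its value in \<open>A\<close>:
  \<open>upper\<close> puts that value into the label of every pair in the relation, and
  \<open>lower\<close> bounds it by a finite join of elements whose relations lie inside. A member
  of the join for \<open>s\<close> that is not below the value of \<open>t\<close> supplies the
  separating pair.\<close>

theorem integral_relation_algebra_separating:
  fixes s t :: "'a tm"
  assumes C: "countable C" and inf: "infinite (UNIV :: 'u set)"
    and st: "vars s \<subseteq> C" "vars t \<subseteq> C" "\<not> tval A (\<lambda>x. x) s \<sqsubseteq> tval A (\<lambda>x. x) t"
  shows "\<exists>R \<in> (Rel_integral :: ('u \<times> 'u) set alg set). \<exists>w. range w \<subseteq> acarrier R \<and>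
    tval R w s \<noteq> tval R w t"
proof -
  obtain V :: "('a \<times> bool + nat) set" and L where V: "countable V" and N: "network V L"
    and V_ne: "V \<noteq> {}"
    and sat: "\<And>u v x y. \<lbrakk>u \<in> V; v \<in> V; x \<in> C; y \<in> C; acomp A x y \<in> L u v\<rbrakk>
        \<Longrightarrow> \<exists>w\<in>V. x \<in> L u w \<and> y \<in> L w v"
    and edge: "\<And>c. \<lbrakk>c \<in> C; \<not> c \<sqsubseteq> azero A\<rbrakk> \<Longrightarrow> \<exists>p\<in>V. \<exists>q\<in>V. L p q = up c"
    by (rule saturated_network[OF C]) (assumption | blast)+
  obtain e :: "nat \<Rightarrow> 'u" where "inj e"
    using inf infinite_countable_subset by blast
  \<comment> \<open>Countably many points fit into the arbitrary infinite type
    \<open>'u\<close>.\<close>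
  define g where "g = e \<circ> to_nat_on V"
  have g: "inj_on g V"
    unfolding g_def using V \<open>inj e\<close> by (intro comp_inj_on) (auto intro: inj_on_subset)
  then have g_eq [simp]: "g p = g q \<longleftrightarrow> p = q" if "p \<in> V" "q \<in> V" for p q
    using that by (auto dest: inj_onD)
  define rep where "rep c = {(g p, g q) | p q. p \<in> V \<and> q \<in> V \<and> c \<in> L p q}" for c
  define I where "I = Id_on (g ` V)"
  have rep_iff [simp]: "(g p, g q) \<in> rep c \<longleftrightarrow> c \<in> L p q" if "p \<in> V" "q \<in> V" for p q c
    using that by (auto simp: rep_def)
  have I_iff [simp]: "(g p, g q) \<in> I \<longleftrightarrow> p = q" if "p \<in> V" "q \<in> V" for p q
    using that by (auto simp: I_def Id_on_def)
  have rep_sub: "rep c \<subseteq> g ` V \<times> g ` V" for c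
    by (auto simp: rep_def)
  have I_sub: "I \<subseteq> g ` V \<times> g ` V"
    by (auto simp: I_def)
  have rep_zero: "rep (azero A) = {}"
    using lfilter_zero[OF network_lfilter[OF N]] by (auto simp: rep_def)
  have rep_meet: "rep (ameet A x y) = rep x \<inter> rep y" if "x \<in> C" "y \<in> C" for x y
    using lfilter_meet[OF network_lfilter[OF N] that] by (auto simp: rep_def) blast
  have rep_comp: "rep (acomp A x y) = rep x O rep y" if "x \<in> C" "y \<in> C" for x y
  proof
    show "rep (acomp A x y) \<subseteq> rep x O rep y"
    proof
      fix z assume "z \<in> rep (acomp A x y)"
      then obtain p q where "z = (g p, g q)" "p \<in> V" "q \<in> V" "acomp A x y \<in> L p q"
        unfolding rep_def by blast
      then show "z \<in> rep x O rep y"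
        using sat[of p q x y] that unfolding rep_def by blast
    qed
    show "rep x O rep y \<subseteq> rep (acomp A x y)"
    proof
      fix z assume "z \<in> rep x O rep y"
      then obtain p q q' r where z: "z = (g p, g r)" "g q = g q'" "x \<in> L p q" "y \<in> L q' r"
          "p \<in> V" "q \<in> V" "q' \<in> V" "r \<in> V"
        unfolding rep_def by blast
      then have "acomp A x y \<in> L p r"
        using network_comp[OF N, of x p q y r] by simp
      then show "z \<in> rep (acomp A x y)"
        using z by simp
    qed
  qed
  \<comment> \<open>All loops have label \<open>up (aone A)\<close>, so \<open>rep c\<close>
    contains all of them or none.\<close>
  have I_rep: "rep c \<inter> I = (if aone A \<sqsubseteq> c then I else {})" if "c \<in> C" for c
    using that network_loop[OF N] by (auto simp: I_def up_def)
  \<comment> \<open>\<open>I\<close> need not be one of the relations \<open>rep c\<close> and is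
    therefore a generator of its own. Composition with it changes no generator, and intersection
    with it gives \<open>I\<close> or the empty relation.\<close>
  define G where "G = insert I (rep ` C)"
  define K where "K = fin_unions G"
  define R where "R = \<lparr>acarrier = K, ajoin = (\<union>), ameet = (\<inter>), acomp = (O), azero = {}, aone = I\<rparr>"
  have K_sub: "X \<subseteq> g ` V \<times> g ` V" if "X \<in> K" for X
    using that unfolding K_def
    by induction (use rep_sub I_sub in \<open>auto simp: G_def\<close>)
  have IO: "I O X = X" "X O I = X" if "X \<in> G" for X
    using that rep_sub I_sub unfolding G_def I_def by blast+
  have comp_G: "X O Y \<in> fin_unions G" if XY: "X \<in> G" "Y \<in> G" for X Y
  proof (cases "X = I \<or> Y = I")
    case False
    then obtain x y where "x \<in> C" "y \<in> C" "X = rep x" "Y = rep y"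
      using XY by (auto simp: G_def)
    then have "X O Y \<in> G"
      using rep_comp[of x y] comp_closed[of x y] unfolding G_def by blast
    then show ?thesis
      by (rule fin_unions.base)
  qed (use IO XY in \<open>auto intro: fin_unions.base\<close>)
  have G_I: "X \<inter> I \<in> {I, {}}" if X: "X \<in> G" for X
  proof (cases "X = I")
    case False
    then obtain c where "c \<in> C" "X = rep c"
      using X by (auto simp: G_def)
    then show ?thesis
      using I_rep[of c] by simp
  qed simp
  have meet_G: "X \<inter> Y \<in> fin_unions G" if XY: "X \<in> G" "Y \<in> G" for X Y
  proof (cases "X = I \<or> Y = I")
    case True
    then have "X \<inter> Y \<in> {I, {}}"
      using XY G_I[of X] G_I[of Y] Int_commute[of I Y] by auto
    then show ?thesis
      by (auto simp: G_def intro: fin_unions.intros)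
  next
    case False
    then obtain x y where "x \<in> C" "y \<in> C" "X = rep x" "Y = rep y"
      using XY by (auto simp: G_def)
    then have "X \<inter> Y \<in> G"
      using rep_meet[of x y] meet_closed[of x y] unfolding G_def by blast
    then show ?thesis
      by (rule fin_unions.base)
  qed
  have "algebra R"
    unfolding algebra_def R_def K_def using fin_unions_additive[of _ G _ "(\<inter>)", OF _ _ meet_G]
      fin_unions_additive[of _ G _ "(O)", OF _ _ comp_G]
    by (auto simp: G_def intro: fin_unions.intros)
  then have "relation_algebra R"
    unfolding relation_algebra_def subalgebra_def homomorphism_def full_rel_alg_def
    using K_sub by (intro exI[of _ "g ` V"]) (auto simp: R_def I_def)
  moreover have "integral R"
  proof -
    have "X \<inter> I \<in> {{}, I}" if "X \<in> K" for X
      using that unfolding K_def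
    proof induction
      case (base X)
      then show ?case using G_I by blast
    next
      case (union X Y)
      then show ?case by (auto simp: Int_Un_distrib2)
    qed simp
    moreover have "I \<noteq> {}"
      using V_ne by (auto simp: I_def)
    ultimately show ?thesis
      unfolding integral_def R_def by fastforce
  qed
  ultimately have R: "R \<in> Rel_integral"
    by (simp add: Rel_integral_def)
  \<comment> \<open>The empty relation is a default that keeps the whole range of \<open>w\<close>
    in the carrier.\<close>
  define w where "w x = (if x \<in> C then rep x else {})" for x
  have w: "range w \<subseteq> acarrier R"
    by (auto simp: w_def R_def K_def G_def intro: fin_unions.intros)
  have tval_K: "tval R w t \<in> K" for t
    using w \<open>algebra R\<close> by (induction t) (auto simp: algebra_def R_def)
  \<comment> \<open>The converse can fail at joins, since labels need not be prime filters.\<close>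
  have upper: "tval A (\<lambda>x. x) t \<in> L p q"
    if "(g p, g q) \<in> tval R w t" "p \<in> V" "q \<in> V" "vars t \<subseteq> C" for t p q
    using that
  proof (induction t arbitrary: p q)
    case (TVar x)
    then show ?case by (simp add: w_def)
  next
    case TOne
    then show ?case
      using network_loop[OF N] by (simp add: R_def up_def)
  next
    case (TJoin t1 t2)
    then have "tval A (\<lambda>x. x) t1 \<in> L p q \<or> tval A (\<lambda>x. x) t2 \<in> L p q"
      by (auto simp: R_def)
    then show ?case
      using lfilter_upward[OF network_lfilter[OF N]] TJoin.prems tval_closed le_join1 le_join2
      by fastforce
  next
    case (TMeet t1 t2)
    then show ?case
      using lfilter_meet[OF network_lfilter[OF N]] tval_closed by (auto simp: R_def)
  next
    case (TComp t1 t2)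
    then obtain c where c: "(g p, c) \<in> tval R w t1" "(c, g q) \<in> tval R w t2"
      by (auto simp: R_def)
    then obtain r where "c = g r" "r \<in> V"
      using K_sub[OF tval_K] by blast
    then show ?case
      using TComp c
        network_comp[OF N, of "tval A (\<lambda>x. x) t1" p r "tval A (\<lambda>x. x) t2" q] by auto
  qed (simp add: R_def)
  (* The relation rep (aone A) may be larger than the identity I that interprets the term 1;
     hence the separate clause for I. *)
  define below where "below t = {c \<in> C. rep c \<subseteq> tval R w t \<or> c = aone A \<and> I \<subseteq> tval R w t}" for t
  \<comment> \<open>This takes the place of the converse of \<open>upper\<close>. Meet and
    composition distribute over joins, so by \<open>covered_additive\<close> only pairs of single
    elements matter in their inductive steps.\<close>
  have lower: "covered (below t) (tval A (\<lambda>x. x) t)" if "vars t \<subseteq> C" for t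
    using that
  proof (induction t)
    case (TVar x)
    then show ?case
      by (intro covered.elem[of x]) (auto simp: below_def w_def)
  next
    case TZero
    then show ?case
      by (auto intro: covered.zero)
  next
    case TOne
    then show ?case
      by (intro covered.elem[of "aone A"]) (auto simp: below_def R_def)
  next
    case (TJoin t1 t2)
    have "covered (below (TJoin t1 t2)) (tval A (\<lambda>x. x) t1)"
      by (rule covered_mono[OF TJoin.IH(1)]) (use TJoin.prems in \<open>auto simp: below_def R_def\<close>)
    moreover have "covered (below (TJoin t1 t2)) (tval A (\<lambda>x. x) t2)"
      by (rule covered_mono[OF TJoin.IH(2)]) (use TJoin.prems in \<open>auto simp: below_def R_def\<close>)
    ultimately show ?case
      by (rule covered.join) (use TJoin.prems tval_closed in auto)
  next
    case (TMeet t1 t2)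
    have *: "covered (below (TMeet t1 t2)) (ameet A c d)"
      if cd: "c \<in> below t1" "d \<in> below t2" "c \<in> C" "d \<in> C" for c d
    proof (cases "rep c \<subseteq> tval R w t1 \<and> rep d \<subseteq> tval R w t2")
      case True
      then show ?thesis
        using cd rep_meet[OF cd(3,4)]
        by (intro covered.elem[of "ameet A c d"]) (auto simp: below_def R_def)
    next
      case False
      \<comment> \<open>This handles a factor that is present only through the clause for
        \<open>I\<close>: then \<open>ameet A c d\<close> lies below \<open>aone A\<close>, and the
        value of the meet contains \<open>I\<close>.\<close>
      have key: "covered (below (TMeet t1 t2)) (ameet A c d)"
        if "I \<subseteq> tval R w t1" "I \<subseteq> tval R w t2" "c = aone A \<or> d = aone A"
        using that cd meet_le1[of c d] meet_le2[of c d]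
        by (intro covered.elem[of "aone A"]) (auto simp: below_def R_def)
      consider "c = aone A" "I \<subseteq> tval R w t1" "rep d \<subseteq> tval R w t2 \<or> I \<subseteq> tval R w t2"
        | "d = aone A" "I \<subseteq> tval R w t2" "rep c \<subseteq> tval R w t1 \<or> I \<subseteq> tval R w t1"
        using False cd by (auto simp: below_def)
      then show ?thesis
      proof cases
        case 1
        show ?thesis
        \<comment> \<open>Atomicity decides: either \<open>rep d\<close> contains every loop, or
          \<open>ameet A (aone A) d\<close> is below \<open>azero A\<close> and covered by the empty
          join.\<close>
        proof (cases "aone A \<sqsubseteq> d")
          case True
          then have "I \<subseteq> tval R w t2"
            using 1 I_rep[OF cd(4)] by auto
          then show ?thesis using key 1 by blast
        next
          case False
          then show ?thesis
            using one_atom[OF cd(4)] 1 cd by (auto intro: covered.zero)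
        qed
      next
        case 2
        show ?thesis
        proof (cases "aone A \<sqsubseteq> c")
          case True
          then have "I \<subseteq> tval R w t1"
            using 2 I_rep[OF cd(3)] by auto
          then show ?thesis using key 2 by blast
        next
          case False
          have "ameet A c d \<sqsubseteq> ameet A (aone A) c"
            using 2 cd meet_greatest[of "ameet A c d" "aone A" c] meet_le1[of c d] meet_le2[of c d]
            by simp
          then show ?thesis
            using one_atom[OF cd(3)] False cd trans by (auto intro!: covered.zero)
        qed
      qed
    qed
    have "covered (below (TMeet t1 t2)) (ameet A (tval A (\<lambda>x. x) t1) (tval A (\<lambda>x. x) t2))"
      by (rule covered_additive[OF TMeet.IH(1) TMeet.IH(2) *])
        (use TMeet.prems meet_mono meet_le1 meet_le2 meet_join join_meet in auto)
    then show ?case by simp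
  next
    case (TComp t1 t2)
    have *: "covered (below (TComp t1 t2)) (acomp A c d)"
      if cd: "c \<in> below t1" "d \<in> below t2" "c \<in> C" "d \<in> C" for c d
    proof (rule covered.elem[of "acomp A c d"])
      have IO_rep: "I O rep x = rep x" "rep x O I = rep x" if "x \<in> C" for x
        using IO[of "rep x"] that by (auto simp: G_def)
      have "I O I = I"
        using IO[of I] by (simp add: G_def)
      have TC: "tval R w (TComp t1 t2) = tval R w t1 O tval R w t2"
        by (simp add: R_def)
      consider "rep c \<subseteq> tval R w t1" "rep d \<subseteq> tval R w t2"
        | "c = aone A" "I \<subseteq> tval R w t1" "rep d \<subseteq> tval R w t2"
        | "rep c \<subseteq> tval R w t1" "d = aone A" "I \<subseteq> tval R w t2"
        | "c = aone A" "d = aone A" "I \<subseteq> tval R w t1" "I \<subseteq> tval R w t2"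
        using cd unfolding below_def by blast
      then have "rep (acomp A c d) \<subseteq> tval R w (TComp t1 t2) \<or>
          acomp A c d = aone A \<and> I \<subseteq> tval R w (TComp t1 t2)"
      proof cases
        case 1
        then show ?thesis
          unfolding TC using rep_comp[OF cd(3,4)] relcomp_mono[OF 1] by simp
      next
        case 2
        then show ?thesis
          unfolding TC using IO_rep[OF cd(4)] relcomp_mono[OF 2(2,3)] cd by simp
      next
        case 3
        then show ?thesis
          unfolding TC using IO_rep[OF cd(3)] relcomp_mono[OF 3(1,3)] cd by simp
      next
        case 4
        then show ?thesis
          unfolding TC using \<open>I O I = I\<close> relcomp_mono[OF 4(3,4)] by simp
      qed
      then show "acomp A c d \<in> below (TComp t1 t2)"
        using cd by (simp add: below_def)
    qed (use cd in auto)
    have "covered (below (TComp t1 t2)) (acomp A (tval A (\<lambda>x. x) t1) (tval A (\<lambda>x. x) t2))"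
      by (rule covered_additive[OF TComp.IH(1) TComp.IH(2) *])
        (use TComp.prems comp_mono comp_join join_comp in auto)
    then show ?case by simp
  qed
  obtain c where c: "c \<in> below s" "\<not> c \<sqsubseteq> tval A (\<lambda>x. x) t"
    using covered_least[OF lower[OF st(1)] tval_closed[OF st(2)]] st(3) by blast
  \<comment> \<open>A pair labelled exactly \<open>up c\<close> cannot lie in the relation of
    \<open>t\<close>, because \<open>c\<close> is not below the value of \<open>t\<close> in
    \<open>A\<close>. Such a pair is an edge generated by \<open>c\<close>, or any loop when
    \<open>c\<close> counts only through the clause for \<open>I\<close>.\<close>
  have "\<exists>p\<in>V. \<exists>q\<in>V. (g p, g q) \<in> tval R w s \<and> L p q = up c"
  proof (cases "rep c \<subseteq> tval R w s")
    case True
    have "c \<in> C"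
      using c by (simp add: below_def)
    moreover have "\<not> c \<sqsubseteq> azero A"
      using c(2) \<open>c \<in> C\<close> zero_le trans tval_closed[OF st(2)] zero_closed by blast
    ultimately obtain p q where "p \<in> V" "q \<in> V" "L p q = up c"
      using edge by blast
    moreover then have "(g p, g q) \<in> rep c"
      using \<open>c \<in> C\<close> by (simp add: up_def)
    ultimately show ?thesis
      using True by blast
  next
    case False
    then have "c = aone A" "I \<subseteq> tval R w s"
      using c by (auto simp: below_def)
    moreover obtain p where "p \<in> V"
      using V_ne by blast
    ultimately show ?thesis
      using network_loop[OF N, of p] I_iff[of p p] by blast
  qed
  then have "tval R w s \<noteq> tval R w t"
    using upper st(2) c(2) unfolding up_def by blast
  then show ?thesis
    using R w by blast
qed

end

section \<open>Making the identity an atom\<close>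

locale integral_model =
  fixes A :: "'a alg"
  assumes model: "A \<in> models Ax_integral"
begin

abbreviation C where "C \<equiv> acarrier A"
abbreviation join (infixl "\<oplus>" 65) where "x \<oplus> y \<equiv> ajoin A x y"
abbreviation meet (infixl "\<otimes>" 70) where "x \<otimes> y \<equiv> ameet A x y"
abbreviation comp (infixl "\<odot>" 75) where "x \<odot> y \<equiv> acomp A x y"
abbreviation zero ("\<zero>") where "\<zero> \<equiv> azero A"
abbreviation one ("\<one>") where "\<one> \<equiv> aone A"

section \<open>The axioms as identities between elements\<close>

lemma closed [simp]:
  "\<zero> \<in> C" "\<one> \<in> C"
  "\<lbrakk>x \<in> C; y \<in> C\<rbrakk> \<Longrightarrow> x \<oplus> y \<in> C" "\<lbrakk>x \<in> C; y \<in> C\<rbrakk> \<Longrightarrow> x \<otimes> y \<in> C"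
  "\<lbrakk>x \<in> C; y \<in> C\<rbrakk> \<Longrightarrow> x \<odot> y \<in> C"
  using model by (auto simp: models_def algebra_def)

text \<open>One valuation serves all axioms: variables 0, 1, 2 and 4 are set explicitly, and every
  other variable, in particular 3, gets \<open>x'\<close>.\<close>

lemma axiom:
  assumes "(s \<^bold>= t) \<in> Ax_integral" "x \<in> C" "y \<in> C" "z \<in> C" "x' \<in> C" "y' \<in> C"
  shows "eval A ((\<lambda>_. x')(0 := x, 1 := y, 2 := z, 4 := y')) s =
    eval A ((\<lambda>_. x')(0 := x, 1 := y, 2 := z, 4 := y')) t"
proof -
  have "satisfies A (s \<^bold>= t)"
    using model assms(1) by (auto simp: models_def)
  moreover have "range ((\<lambda>_. x')(0 := x, 1 := y, 2 := z, 4 := y')) \<subseteq> C"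
    using assms by auto
  ultimately show ?thesis
    unfolding satisfies.simps by blast
qed

lemmas Ax_defs = Ax_integral_def Ax_distrib_lattice_def Ax_monoid_def Let_def

lemma meet_idem: "x \<in> C \<Longrightarrow> x \<otimes> x = x"
  using axiom[of "Var 0 \<^bold>\<cdot> Var 0" "Var 0" x x x x x] by (simp add: Ax_defs)

lemma join_comm: "\<lbrakk>x \<in> C; y \<in> C\<rbrakk> \<Longrightarrow> x \<oplus> y = y \<oplus> x"
  using axiom[of "Var 0 \<^bold>+ Var 1" "Var 1 \<^bold>+ Var 0" x y x x x] by (simp add: Ax_defs)

lemma meet_comm: "\<lbrakk>x \<in> C; y \<in> C\<rbrakk> \<Longrightarrow> x \<otimes> y = y \<otimes> x"
  using axiom[of "Var 0 \<^bold>\<cdot> Var 1" "Var 1 \<^bold>\<cdot> Var 0" x y x x x] by (simp add: Ax_defs)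

lemma join_assoc: "\<lbrakk>x \<in> C; y \<in> C; z \<in> C\<rbrakk> \<Longrightarrow> x \<oplus> y \<oplus> z = x \<oplus> (y \<oplus> z)"
  using axiom[of "Var 0 \<^bold>+ Var 1 \<^bold>+ Var 2" "Var 0 \<^bold>+ (Var 1 \<^bold>+ Var 2)" x y z x x]
  by (simp add: Ax_defs)

lemma meet_assoc: "\<lbrakk>x \<in> C; y \<in> C; z \<in> C\<rbrakk> \<Longrightarrow> x \<otimes> y \<otimes> z = x \<otimes> (y \<otimes> z)"
  using axiom[of "Var 0 \<^bold>\<cdot> Var 1 \<^bold>\<cdot> Var 2" "Var 0 \<^bold>\<cdot> (Var 1 \<^bold>\<cdot> Var 2)" x y z x x]
  by (simp add: Ax_defs)

lemma meet_join_absorb: "\<lbrakk>x \<in> C; y \<in> C\<rbrakk> \<Longrightarrow> x \<otimes> (x \<oplus> y) = x"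
  using axiom[of "Var 0 \<^bold>\<cdot> (Var 0 \<^bold>+ Var 1)" "Var 0" x y x x x] by (simp add: Ax_defs)

lemma meet_join_distrib: "\<lbrakk>x \<in> C; y \<in> C; z \<in> C\<rbrakk> \<Longrightarrow> x \<otimes> (y \<oplus> z) = x \<otimes> y \<oplus> x \<otimes> z"
  using axiom[of "Var 0 \<^bold>\<cdot> (Var 1 \<^bold>+ Var 2)" "Var 0 \<^bold>\<cdot> Var 1 \<^bold>+ Var 0 \<^bold>\<cdot> Var 2" x y z x x]
  by (simp add: Ax_defs)

lemma join_meet_distrib: "\<lbrakk>x \<in> C; y \<in> C; z \<in> C\<rbrakk> \<Longrightarrow> x \<oplus> y \<otimes> z = (x \<oplus> y) \<otimes> (x \<oplus> z)"
  using axiom[of "Var 0 \<^bold>+ Var 1 \<^bold>\<cdot> Var 2" "(Var 0 \<^bold>+ Var 1) \<^bold>\<cdot> (Var 0 \<^bold>+ Var 2)" x y z x x]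
  by (simp add: Ax_defs)

lemma comp_assoc: "\<lbrakk>x \<in> C; y \<in> C; z \<in> C\<rbrakk> \<Longrightarrow> x \<odot> y \<odot> z = x \<odot> (y \<odot> z)"
  using axiom[of "Var 0 \<^bold>\<circ> Var 1 \<^bold>\<circ> Var 2" "Var 0 \<^bold>\<circ> (Var 1 \<^bold>\<circ> Var 2)" x y z x x]
  by (simp add: Ax_defs)

lemma one_comp [simp]: "x \<in> C \<Longrightarrow> \<one> \<odot> x = x"
  using axiom[of "\<^bold>1 \<^bold>\<circ> Var 0" "Var 0" x x x x x] by (simp add: Ax_defs)

lemma comp_one [simp]: "x \<in> C \<Longrightarrow> x \<odot> \<one> = x"
  using axiom[of "Var 0 \<^bold>\<circ> \<^bold>1" "Var 0" x x x x x] by (simp add: Ax_defs)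

lemma zero_meet: "x \<in> C \<Longrightarrow> \<zero> \<otimes> x = \<zero>"
  using axiom[of "\<^bold>0" "\<^bold>0 \<^bold>\<cdot> Var 0" x x x x x] by (simp add: Ax_defs)

lemma zero_comp [simp]: "x \<in> C \<Longrightarrow> \<zero> \<odot> x = \<zero>"
  using axiom[of "\<^bold>0" "\<^bold>0 \<^bold>\<circ> Var 0" x x x x x] by (simp add: Ax_defs)

lemma comp_zero [simp]: "x \<in> C \<Longrightarrow> x \<odot> \<zero> = \<zero>"
  using axiom[of "\<^bold>0" "Var 0 \<^bold>\<circ> \<^bold>0" x x x x x] by (simp add: Ax_defs)

lemma comp_meet_mono:
  "\<lbrakk>x \<in> C; y \<in> C; x' \<in> C; y' \<in> C\<rbrakk>
    \<Longrightarrow> ((x \<otimes> x') \<odot> (y \<otimes> y')) \<otimes> (x \<odot> y) = (x \<otimes> x') \<odot> (y \<otimes> y')"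
  using axiom[of "((Var 0 \<^bold>\<cdot> Var 3) \<^bold>\<circ> (Var 1 \<^bold>\<cdot> Var 4)) \<^bold>\<cdot> (Var 0 \<^bold>\<circ> Var 1)"
      "(Var 0 \<^bold>\<cdot> Var 3) \<^bold>\<circ> (Var 1 \<^bold>\<cdot> Var 4)" x y x x' y']
  by (simp add: Ax_defs)

lemma subid_comp_subid:
  "\<lbrakk>x \<in> C; y \<in> C\<rbrakk> \<Longrightarrow> (\<one> \<otimes> x) \<odot> (\<one> \<otimes> y) = \<one> \<otimes> x \<otimes> y"
  using axiom[of "(\<^bold>1 \<^bold>\<cdot> Var 0) \<^bold>\<circ> (\<^bold>1 \<^bold>\<cdot> Var 1)" "\<^bold>1 \<^bold>\<cdot> Var 0 \<^bold>\<cdot> Var 1" x y x x x]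
  by (simp add: Ax_defs)

lemma subid_comp_meet:
  "\<lbrakk>x \<in> C; y \<in> C; z \<in> C\<rbrakk> \<Longrightarrow> (\<one> \<otimes> x) \<odot> (y \<otimes> z) = ((\<one> \<otimes> x) \<odot> y) \<otimes> z"
  using axiom[of "(\<^bold>1 \<^bold>\<cdot> Var 0) \<^bold>\<circ> (Var 1 \<^bold>\<cdot> Var 2)" "((\<^bold>1 \<^bold>\<cdot> Var 0) \<^bold>\<circ> Var 1) \<^bold>\<cdot> Var 2" x y z x x]
  by (simp add: Ax_defs)

lemma cyclic_eq: "\<lbrakk>x \<in> C; y \<in> C\<rbrakk> \<Longrightarrow> \<one> \<otimes> (x \<odot> y) = \<one> \<otimes> (y \<odot> x)"
  using axiom[of "\<^bold>1 \<^bold>\<cdot> (Var 0 \<^bold>\<circ> Var 1)" "\<^bold>1 \<^bold>\<cdot> (Var 1 \<^bold>\<circ> Var 0)" x y x x x]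
  by (simp add: Ax_defs)

lemma subid_central: "\<lbrakk>x \<in> C; y \<in> C\<rbrakk> \<Longrightarrow> (\<one> \<otimes> x) \<odot> y = y \<odot> (\<one> \<otimes> x)"
  using axiom[of "(\<^bold>1 \<^bold>\<cdot> Var 0) \<^bold>\<circ> Var 1" "Var 1 \<^bold>\<circ> (\<^bold>1 \<^bold>\<cdot> Var 0)" x y x x x]
  by (simp add: Ax_defs)

lemma join_comp: "\<lbrakk>x \<in> C; y \<in> C; z \<in> C\<rbrakk> \<Longrightarrow> (x \<oplus> y) \<odot> z = x \<odot> z \<oplus> y \<odot> z"
  using axiom[of "(Var 0 \<^bold>+ Var 1) \<^bold>\<circ> Var 2" "(Var 0 \<^bold>\<circ> Var 2) \<^bold>+ (Var 1 \<^bold>\<circ> Var 2)" x y z x x]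
  by (simp add: Ax_defs)

lemma comp_join: "\<lbrakk>x \<in> C; y \<in> C; z \<in> C\<rbrakk> \<Longrightarrow> x \<odot> (y \<oplus> z) = x \<odot> y \<oplus> x \<odot> z"
  using axiom[of "Var 0 \<^bold>\<circ> (Var 1 \<^bold>+ Var 2)" "(Var 0 \<^bold>\<circ> Var 1) \<^bold>+ (Var 0 \<^bold>\<circ> Var 2)" x y z x x]
  by (simp add: Ax_defs)

section \<open>The lattice order and the elements below the identity\<close>

definition leq (infix "\<preceq>" 50) where
  "x \<preceq> y \<longleftrightarrow> x \<in> C \<and> y \<in> C \<and> x \<otimes> y = x"

lemma leq_refl: "x \<in> C \<Longrightarrow> x \<preceq> x"
  by (simp add: leq_def meet_idem)

lemma leq_trans: "\<lbrakk>x \<preceq> y; y \<preceq> z\<rbrakk> \<Longrightarrow> x \<preceq> z"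
  unfolding leq_def by (metis meet_assoc)

lemma leq_antisym: "\<lbrakk>x \<preceq> y; y \<preceq> x\<rbrakk> \<Longrightarrow> x = y"
  unfolding leq_def by (metis meet_comm)

lemma meet_leq: "\<lbrakk>x \<in> C; y \<in> C\<rbrakk> \<Longrightarrow> x \<otimes> y \<preceq> x" "\<lbrakk>x \<in> C; y \<in> C\<rbrakk> \<Longrightarrow> x \<otimes> y \<preceq> y"
  unfolding leq_def using meet_assoc meet_comm meet_idem closed(4) by metis+

lemma meet_glb: "\<lbrakk>z \<preceq> x; z \<preceq> y\<rbrakk> \<Longrightarrow> z \<preceq> x \<otimes> y"
  unfolding leq_def by (metis closed(4) meet_assoc)

lemma leq_join: "\<lbrakk>x \<in> C; y \<in> C\<rbrakk> \<Longrightarrow> x \<preceq> x \<oplus> y" "\<lbrakk>x \<in> C; y \<in> C\<rbrakk> \<Longrightarrow> y \<preceq> x \<oplus> y"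
  unfolding leq_def using meet_join_absorb join_comm closed(3) by metis+

lemma join_lub: "\<lbrakk>x \<preceq> z; y \<preceq> z\<rbrakk> \<Longrightarrow> x \<oplus> y \<preceq> z"
  unfolding leq_def by (metis closed(3) meet_comm meet_join_distrib)

lemma comp_leq_mono: "\<lbrakk>x \<preceq> x'; y \<preceq> y'\<rbrakk> \<Longrightarrow> x \<odot> y \<preceq> x' \<odot> y'"
  unfolding leq_def using comp_meet_mono[of x' y' x y] by (metis closed(5) meet_comm)

lemma zero_leq: "x \<in> C \<Longrightarrow> \<zero> \<preceq> x"
  by (simp add: leq_def zero_meet)

lemma subid_eq: "e \<preceq> \<one> \<Longrightarrow> \<one> \<otimes> e = e"
  unfolding leq_def by (metis meet_comm)

lemma subid_idem: "e \<preceq> \<one> \<Longrightarrow> e \<odot> e = e"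
  using subid_comp_subid[of e e] subid_eq[of e] by (simp add: leq_def meet_idem)

lemma subid_comm: "\<lbrakk>e \<preceq> \<one>; x \<in> C\<rbrakk> \<Longrightarrow> e \<odot> x = x \<odot> e"
  using subid_central[of e x] subid_eq[of e] by (simp add: leq_def)

lemma subid_meet: "\<lbrakk>e \<preceq> \<one>; x \<in> C; y \<in> C\<rbrakk> \<Longrightarrow> e \<odot> (x \<otimes> y) = (e \<odot> x) \<otimes> y"
  using subid_comp_meet[of e x y] subid_eq[of e] by (simp add: leq_def)

lemma subid_comp_leq: "\<lbrakk>e \<preceq> \<one>; x \<in> C\<rbrakk> \<Longrightarrow> e \<odot> x \<preceq> x"
  using comp_leq_mono[of e \<one> x x] leq_refl[of x] by simp

section \<open>Compatible preorders\<close>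

text \<open>These encode congruences: the pairs related in both directions form a congruence, and
  the preorder is the order of the quotient pulled back to \<open>A\<close>.\<close>

definition compat :: "('a \<times> 'a) set \<Rightarrow> bool" where
  "compat r \<longleftrightarrow> r \<subseteq> C \<times> C \<and> (\<forall>x y. x \<preceq> y \<longrightarrow> (x, y) \<in> r) \<and>
     (\<forall>x y z. (x, y) \<in> r \<longrightarrow> (y, z) \<in> r \<longrightarrow> (x, z) \<in> r) \<and>
     (\<forall>x y z. (x, z) \<in> r \<longrightarrow> (y, z) \<in> r \<longrightarrow> (x \<oplus> y, z) \<in> r) \<and>
     (\<forall>x y z. (z, x) \<in> r \<longrightarrow> (z, y) \<in> r \<longrightarrow> (z, x \<otimes> y) \<in> r) \<and>
     (\<forall>x y x' y'. (x, x') \<in> r \<longrightarrow> (y, y') \<in> r \<longrightarrow> (x \<odot> y, x' \<odot> y') \<in> r)"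

lemma compatD:
  assumes "compat r"
  shows "(x, y) \<in> r \<Longrightarrow> x \<in> C" "(x, y) \<in> r \<Longrightarrow> y \<in> C" "x \<preceq> y \<Longrightarrow> (x, y) \<in> r"
    "\<lbrakk>(x, y) \<in> r; (y, z) \<in> r\<rbrakk> \<Longrightarrow> (x, z) \<in> r"
    "\<lbrakk>(x, z) \<in> r; (y, z) \<in> r\<rbrakk> \<Longrightarrow> (x \<oplus> y, z) \<in> r"
    "\<lbrakk>(z, x) \<in> r; (z, y) \<in> r\<rbrakk> \<Longrightarrow> (z, x \<otimes> y) \<in> r"
    "\<lbrakk>(x, x') \<in> r; (y, y') \<in> r\<rbrakk> \<Longrightarrow> (x \<odot> y, x' \<odot> y') \<in> r"
  using assms unfolding compat_def by blast+

lemma compat_leq: "compat {(x, y). x \<preceq> y}"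
  unfolding compat_def using leq_trans join_lub meet_glb comp_leq_mono by (auto simp: leq_def)

text \<open>Each closure condition has at most two pairs as premises, and two pairs lie in a common
  member of the chain.\<close>

lemma compat_Union:
  assumes "\<CC> \<noteq> {}" "\<And>r. r \<in> \<CC> \<Longrightarrow> compat r" "\<And>r s. \<lbrakk>r \<in> \<CC>; s \<in> \<CC>\<rbrakk> \<Longrightarrow> r \<subseteq> s \<or> s \<subseteq> r"
  shows "compat (\<Union>\<CC>)"
proof -
  have two: "\<exists>r\<in>\<CC>. p \<in> r \<and> q \<in> r" if "p \<in> \<Union>\<CC>" "q \<in> \<Union>\<CC>" for p q
    using that assms(3) by blast
  show ?thesis
    unfolding compat_def
  proof (intro conjI allI impI)
    show "\<Union>\<CC> \<subseteq> C \<times> C"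
      using assms(2) unfolding compat_def by blast
    show "(x, y) \<in> \<Union>\<CC>" if "x \<preceq> y" for x y
      using assms(1,2) that compatD(3) by blast
    show "(x, z) \<in> \<Union>\<CC>" if "(x, y) \<in> \<Union>\<CC>" "(y, z) \<in> \<Union>\<CC>" for x y z
      using two[OF that] assms(2) compatD(4) by blast
    show "(x \<oplus> y, z) \<in> \<Union>\<CC>" if "(x, z) \<in> \<Union>\<CC>" "(y, z) \<in> \<Union>\<CC>" for x y z
      using two[OF that] assms(2) compatD(5) by blast
    show "(z, x \<otimes> y) \<in> \<Union>\<CC>" if "(z, x) \<in> \<Union>\<CC>" "(z, y) \<in> \<Union>\<CC>" for x y z
      using two[OF that] assms(2) compatD(6) by blast
    show "(x \<odot> y, x' \<odot> y') \<in> \<Union>\<CC>" if "(x, x') \<in> \<Union>\<CC>" "(y, y') \<in> \<Union>\<CC>" for x y x' y'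
      using two[OF that] assms(2) compatD(7) by blast
  qed
qed

text \<open>The next two constructions enlarge a compatible preorder so that a given element \<open>e\<close> below
  the identity becomes equivalent to \<open>\<one>\<close> and to \<open>\<zero>\<close>, respectively.\<close>

lemma compat_subid_one:
  assumes r: "compat r" and e: "e \<preceq> \<one>"
  shows "compat {(x, y) \<in> C \<times> C. (e \<odot> x, y) \<in> r}" (is "compat ?r'")
proof -
  have eC: "e \<in> C" using e by (simp add: leq_def)
  have ee: "e \<odot> (e \<odot> x) = e \<odot> x" if "x \<in> C" for x
    using comp_assoc[of e e x] that eC subid_idem[OF e] by simp
  show ?thesis
    unfolding compat_def
  proof (intro conjI allI impI)
    show "(x, y) \<in> ?r'" if "x \<preceq> y" for x y
    proof -
      have c: "x \<in> C" "y \<in> C"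
        using that by (auto simp: leq_def)
      then show ?thesis
        using compatD(3)[OF r leq_trans[OF subid_comp_leq[OF e c(1)] that]] by simp
    qed
    show "(x, z) \<in> ?r'" if "(x, y) \<in> ?r'" "(y, z) \<in> ?r'" for x y z
    proof -
      \<comment> \<open>Multiplying the first pair by \<open>e\<close> once more makes it fit the
        second, and idempotence removes the extra factor.\<close>
      have "(e \<odot> (e \<odot> x), e \<odot> y) \<in> r"
        using that compatD(7)[OF r] compatD(3)[OF r leq_refl[OF eC]] by simp
      then show ?thesis
        using that ee compatD(4)[OF r] by auto
    qed
    show "(x \<oplus> y, z) \<in> ?r'" if "(x, z) \<in> ?r'" "(y, z) \<in> ?r'" for x y z
      using that compatD(5)[OF r] eC by (auto simp: comp_join)
    show "(z, x \<otimes> y) \<in> ?r'" if "(z, x) \<in> ?r'" "(z, y) \<in> ?r'" for x y z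
      using that compatD(6)[OF r] by auto
    show "(x \<odot> y, x' \<odot> y') \<in> ?r'" if xy: "(x, x') \<in> ?r'" "(y, y') \<in> ?r'" for x y x' y'
    proof -
      \<comment> \<open>Idempotence doubles \<open>e\<close>, and centrality carries one copy over
        to \<open>y\<close>.\<close>
      have "e \<odot> (x \<odot> y) = e \<odot> (e \<odot> x) \<odot> y"
        using xy eC ee comp_assoc[of e x y] by simp
      also have "\<dots> = e \<odot> (x \<odot> e) \<odot> y"
        using xy eC subid_comm[OF e, of x] by simp
      also have "\<dots> = (e \<odot> x) \<odot> (e \<odot> y)"
        using xy eC by (simp add: comp_assoc)
      finally show ?thesis
        using xy compatD(7)[OF r] by auto
    qed
  qed auto
qed

lemma compat_subid_zero:
  assumes r: "compat r" and e: "e \<preceq> \<one>"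
  shows "compat {(x, y) \<in> C \<times> C. \<exists>w\<in>C. (x, y \<oplus> e \<odot> w) \<in> r}" (is "compat ?r'")
proof -
  have eC: "e \<in> C" using e by (simp add: leq_def)
  note tr = compatD(4)[OF r] and le = compatD(3)[OF r]
  have lej: "(y, y \<oplus> z) \<in> r" "(y, z \<oplus> y) \<in> r" if "y \<in> C" "z \<in> C" for y z
    using le leq_join that by auto
  have jmono: "(x \<oplus> y, x' \<oplus> y') \<in> r" if "(x, x') \<in> r" "(y, y') \<in> r" for x x' y y'
    using tr[OF that(1) lej(1)[of x' y']] tr[OF that(2) lej(2)[of y' x']] compatD(2)[OF r] that
    by (intro compatD(5)[OF r]) auto
  \<comment> \<open>The elements \<open>e \<odot> w\<close> are error terms, to be collapsed to
    \<open>\<zero>\<close>. Two of them have the common bound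
    \<open>e \<odot> (w \<oplus> w')\<close>.\<close>
  have absorb: "(y \<oplus> e \<odot> w, y \<oplus> e \<odot> (w \<oplus> w')) \<in> r" "(y \<oplus> e \<odot> w', y \<oplus> e \<odot> (w \<oplus> w')) \<in> r"
    if "y \<in> C" "w \<in> C" "w' \<in> C" for y w w'
    using that eC
    by (intro jmono compatD(7)[OF r] lej le[OF leq_refl]; simp)+
  show ?thesis
    unfolding compat_def
  proof (intro conjI allI impI)
    show "(x, y) \<in> ?r'" if "x \<preceq> y" for x y
    proof -
      have "x \<in> C" "y \<in> C" using that by (auto simp: leq_def)
      then show ?thesis
        using that tr[OF le[OF that] lej(1)[of y "e \<odot> \<zero>"]] eC
        by (auto intro!: bexI[of _ \<zero>])
    qed
    show "(x, z) \<in> ?r'" if xy: "(x, y) \<in> ?r'" and yz: "(y, z) \<in> ?r'" for x y z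
    proof -
      obtain w w' where w: "w \<in> C" "w' \<in> C" "(x, y \<oplus> e \<odot> w) \<in> r" "(y, z \<oplus> e \<odot> w') \<in> r"
        using xy yz by blast
      have c: "x \<in> C" "y \<in> C" "z \<in> C" using xy yz by auto
      have "(y \<oplus> e \<odot> w, z \<oplus> e \<odot> w' \<oplus> e \<odot> w) \<in> r"
        using jmono[OF w(4)] le[OF leq_refl] eC w by simp
      then have "(x, z \<oplus> e \<odot> (w' \<oplus> w)) \<in> r"
        using tr[OF w(3)] w c eC by (simp add: comp_join join_assoc)
      then show ?thesis
        using c w by auto
    qed
    show "(x \<oplus> y, z) \<in> ?r'" if xz: "(x, z) \<in> ?r'" and yz: "(y, z) \<in> ?r'" for x y z
    proof -
      obtain w w' where w: "w \<in> C" "w' \<in> C" "(x, z \<oplus> e \<odot> w) \<in> r" "(y, z \<oplus> e \<odot> w') \<in> r"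
        using xz yz by blast
      have c: "x \<in> C" "y \<in> C" "z \<in> C" using xz yz by auto
      have "(x \<oplus> y, z \<oplus> e \<odot> (w \<oplus> w')) \<in> r"
        using tr[OF w(3) absorb(1)[of z w w']] tr[OF w(4) absorb(2)[of z w w']] w c
        by (intro compatD(5)[OF r]) auto
      then show ?thesis
        using c w by auto
    qed
    show "(z, x \<otimes> y) \<in> ?r'" if zx: "(z, x) \<in> ?r'" and zy: "(z, y) \<in> ?r'" for x y z
    proof -
      obtain w w' where w: "w \<in> C" "w' \<in> C" "(z, x \<oplus> e \<odot> w) \<in> r" "(z, y \<oplus> e \<odot> w') \<in> r"
        using zx zy by blast
      have c: "x \<in> C" "y \<in> C" "z \<in> C" using zx zy by auto
      define W where "W = e \<odot> (w \<oplus> w')"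
      have W: "W \<in> C" using eC w by (simp add: W_def)
      have "(z, (x \<oplus> W) \<otimes> (y \<oplus> W)) \<in> r"
        unfolding W_def
        using tr[OF w(3) absorb(1)[of x w w']] tr[OF w(4) absorb(2)[of y w w']] w c
        by (intro compatD(6)[OF r]) auto
      \<comment> \<open>The common error \<open>W\<close> factors out because join distributes over
        meet.\<close>
      also have "(x \<oplus> W) \<otimes> (y \<oplus> W) = x \<otimes> y \<oplus> W"
        using join_meet_distrib[of W x y] W c by (simp add: join_comm)
      finally show ?thesis
        using c w W_def by auto
    qed
    show "(x \<odot> y, x' \<odot> y') \<in> ?r'" if xx: "(x, x') \<in> ?r'" and yy: "(y, y') \<in> ?r'" for x y x' y'
    proof -
      obtain w w' where w: "w \<in> C" "w' \<in> C" "(x, x' \<oplus> e \<odot> w) \<in> r" "(y, y' \<oplus> e \<odot> w') \<in> r"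
        using xx yy by blast
      have c: "x \<in> C" "y \<in> C" "x' \<in> C" "y' \<in> C" using xx yy by auto
      \<comment> \<open>Centrality brings \<open>e\<close> to the front, so every product with an
        error term in it is again of the form \<open>e \<odot> w\<close>.\<close>
      have 1: "x' \<odot> (e \<odot> w') = e \<odot> (x' \<odot> w')"
        using subid_comm[OF e, of x'] comp_assoc[of x' e w'] comp_assoc[of e x' w'] c w eC by simp
      have "(x \<odot> y, (x' \<oplus> e \<odot> w) \<odot> (y' \<oplus> e \<odot> w')) \<in> r"
        using compatD(7)[OF r w(3,4)] .
      also have "(x' \<oplus> e \<odot> w) \<odot> (y' \<oplus> e \<odot> w') =
          (x' \<odot> y' \<oplus> x' \<odot> (e \<odot> w')) \<oplus> (e \<odot> w) \<odot> (y' \<oplus> e \<odot> w')"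
        using c w eC join_comp[of x' "e \<odot> w" "y' \<oplus> e \<odot> w'"] comp_join[of x' y' "e \<odot> w'"]
        by simp
      also have "\<dots> = x' \<odot> y' \<oplus> e \<odot> (x' \<odot> w' \<oplus> w \<odot> (y' \<oplus> e \<odot> w'))"
        using c w eC 1 by (simp add: comp_join[of e] comp_assoc join_assoc)
      finally show ?thesis
        using c w eC by auto
    qed
  qed auto
qed

text \<open>Zorn's lemma gives a maximal compatible preorder that does not relate \<open>a\<close>
  to \<open>b\<close>. If \<open>e = \<one> \<otimes> x\<close> were equivalent to neither
  \<open>\<zero>\<close> nor \<open>\<one>\<close>, both enlargements by \<open>e\<close> would
  relate \<open>a\<close> to \<open>b\<close>. Then \<open>e \<odot> a\<close> lies below
  \<open>b\<close>, and \<open>a\<close> lies below \<open>b\<close> up to an error term; by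
  distributivity \<open>a\<close> itself lies below \<open>b\<close>.\<close>

lemma maximal_compat:
  assumes ab: "a \<in> C" "b \<in> C" "\<not> a \<preceq> b"
  obtains r where "compat r" "(a, b) \<notin> r"
    "\<And>x. x \<in> C \<Longrightarrow> (\<one> \<otimes> x, \<zero>) \<in> r \<or> (\<one>, x) \<in> r"
proof -
  define S where "S = {r. compat r \<and> (a, b) \<notin> r}"
  have "\<exists>M\<in>S. \<forall>X\<in>S. M \<subseteq> X \<longrightarrow> X = M"
  proof (rule subset_Zorn_nonempty)
    show "S \<noteq> {}"
      using compat_leq ab by (auto simp: S_def)
    show "\<Union>\<CC> \<in> S" if "\<CC> \<noteq> {}" "subset.chain S \<CC>" for \<CC>
      using that compat_Union[of \<CC>] unfolding S_def subset_chain_def by blast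
  qed
  then obtain r where r: "compat r" "(a, b) \<notin> r"
    and max: "\<And>X. \<lbrakk>compat X; (a, b) \<notin> X; r \<subseteq> X\<rbrakk> \<Longrightarrow> X = r"
    unfolding S_def by blast
  note tr = compatD(4)[OF r(1)] and le = compatD(3)[OF r(1)]
  have "(\<one> \<otimes> x, \<zero>) \<in> r \<or> (\<one>, x) \<in> r" if x: "x \<in> C" for x
  proof (rule ccontr)
    assume "\<not> ?thesis"
    then have no: "(\<one> \<otimes> x, \<zero>) \<notin> r" "(\<one>, x) \<notin> r" by auto
    define e where "e = \<one> \<otimes> x"
    have e: "e \<preceq> \<one>" "e \<in> C" "e \<preceq> x"
      using x meet_leq by (auto simp: e_def)
    define r1 where "r1 = {(x, y) \<in> C \<times> C. (e \<odot> x, y) \<in> r}"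
    define r2 where "r2 = {(x, y) \<in> C \<times> C. \<exists>w\<in>C. (x, y \<oplus> e \<odot> w) \<in> r}"
    have "r \<subseteq> r1"
      unfolding r1_def using compatD(1,2)[OF r(1)] tr le subid_comp_leq[OF e(1)] by blast
    moreover have "(\<one>, x) \<in> r1"
      using e x le by (simp add: r1_def)
    ultimately have "(a, b) \<in> r1"
      using max[OF compat_subid_one[OF r(1) e(1)]] no(2) unfolding r1_def by blast
    then have ea: "(e \<odot> a, b) \<in> r"
      by (simp add: r1_def)
    have "r \<subseteq> r2"
    proof (rule subrelI)
      fix y z assume yz: "(y, z) \<in> r"
      then have "(y, z \<oplus> e \<odot> \<zero>) \<in> r"
        using tr le leq_join(1)[of z "e \<odot> \<zero>"] compatD(2)[OF r(1)] e by auto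
      then show "(y, z) \<in> r2"
        using compatD(1,2)[OF r(1) yz] by (auto simp: r2_def)
    qed
    \<comment> \<open>With the witness \<open>\<one>\<close>, the whole of
      \<open>e = e \<odot> \<one>\<close> is an error term.\<close>
    moreover have "(e, \<zero>) \<in> r2"
      using e le leq_join(2)[of \<zero> e] by (auto simp: r2_def intro!: bexI[of _ \<one>])
    ultimately have "(a, b) \<in> r2"
      using max[OF compat_subid_zero[OF r(1) e(1)]] no(1)[folded e_def] unfolding r2_def by blast
    then obtain w where w: "w \<in> C" "(a, b \<oplus> e \<odot> w) \<in> r"
      by (auto simp: r2_def)
    have "(a, a \<otimes> (b \<oplus> e \<odot> w)) \<in> r"
      using w le[OF leq_refl[OF ab(1)]] by (intro compatD(6)[OF r(1)])
    moreover have "(a \<otimes> (b \<oplus> e \<odot> w), b) \<in> r"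
    proof -
      \<comment> \<open>The error term is cut down to \<open>a\<close>: restriction by
        \<open>e\<close> commutes with meets, so this part of \<open>a\<close> lies below
        \<open>e \<odot> a\<close>, which is below \<open>b\<close> by the first
        enlargement.\<close>
      have "a \<otimes> (e \<odot> w) = e \<odot> (w \<otimes> a)"
        using subid_meet[OF e(1) w(1) ab(1)] meet_comm e w ab by simp
      moreover have "e \<odot> (w \<otimes> a) \<preceq> e \<odot> a"
        using comp_leq_mono[OF leq_refl[OF e(2)] meet_leq(2)[OF w(1) ab(1)]] .
      ultimately have "(a \<otimes> (e \<odot> w), b) \<in> r"
        using ea tr le by metis
      moreover have "(a \<otimes> b, b) \<in> r"
        using le meet_leq(2) ab by blast
      ultimately show ?thesis
        using compatD(5)[OF r(1)] ab e w by (simp add: meet_join_distrib)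
    qed
    ultimately show False
      using tr r(2) by blast
  qed
  then show ?thesis
    using that r by blast
qed

text \<open>If \<open>\<one>\<close> were below \<open>\<zero>\<close>, then
  \<open>a = a \<odot> \<one>\<close> would be below \<open>\<zero>\<close> and hence below
  \<open>b\<close>. The subalgebra \<open>D\<close> allows passing to countably many elements once
  \<open>r\<close> has been found on all of \<open>A\<close>.\<close>

lemma integral_alg_preorder_compat:
  assumes r: "compat r" and atom: "\<And>x. x \<in> C \<Longrightarrow> (\<one> \<otimes> x, \<zero>) \<in> r \<or> (\<one>, x) \<in> r"
    and nontrivial: "(a, b) \<notin> r" "a \<in> C" "b \<in> C"
    and D: "D \<subseteq> C" "\<zero> \<in> D" "\<one> \<in> D"
      "\<And>x y. \<lbrakk>x \<in> D; y \<in> D\<rbrakk> \<Longrightarrow> x \<oplus> y \<in> D" "\<And>x y. \<lbrakk>x \<in> D; y \<in> D\<rbrakk> \<Longrightarrow> x \<otimes> y \<in> D"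
      "\<And>x y. \<lbrakk>x \<in> D; y \<in> D\<rbrakk> \<Longrightarrow> x \<odot> y \<in> D"
  shows "integral_alg_preorder A D (\<lambda>x y. (x, y) \<in> r)"
proof -
  have DC: "x \<in> C" if "x \<in> D" for x using D that by blast
  note le = compatD(3)[OF r] and tr = compatD(4)[OF r]
  have "(\<one>, \<zero>) \<notin> r"
  proof
    assume "(\<one>, \<zero>) \<in> r"
    then have "(a, \<zero>) \<in> r"
      using compatD(7)[OF r le[OF leq_refl[OF nontrivial(2)]], of \<one> \<zero>] nontrivial by simp
    then show False
      using tr le[OF zero_leq[OF nontrivial(3)]] nontrivial(1) by blast
  qed
  moreover have "(\<one>, y \<odot> x) \<in> r" if "(\<one>, x \<odot> y) \<in> r" "x \<in> D" "y \<in> D" for x y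
  proof -
    have "(\<one>, \<one> \<otimes> (x \<odot> y)) \<in> r"
      using compatD(6)[OF r le[OF leq_refl] that(1)] by simp
    moreover have "(\<one> \<otimes> (y \<odot> x), y \<odot> x) \<in> r"
      using le[OF meet_leq(2)] that DC by simp
    ultimately show ?thesis
      using tr cyclic_eq[of x y] that DC by auto
  qed
  moreover have "(x \<oplus> y) \<otimes> z = x \<otimes> z \<oplus> y \<otimes> z" if "x \<in> C" "y \<in> C" "z \<in> C" for x y z
    using that meet_join_distrib[of z x y] by (simp add: meet_comm)
  ultimately show ?thesis
    by unfold_locales
      (simp_all add: D DC atom le leq_refl meet_leq leq_join zero_leq compatD(5-7)[OF r] comp_assoc
        meet_join_distrib join_comp comp_join, rule tr)
qed

end

section \<open>Generating the variety\<close>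

text \<open>A tag for the head symbol is paired with the codes of the parts; for constants
  \<open>n 0\<close> is a filler. The pairing is a parameter because codes are taken both in the
  naturals, for countability, and in the index type of the products.\<close>

primrec tm_code :: "('k \<times> 'k \<Rightarrow> 'k) \<Rightarrow> (nat \<Rightarrow> 'k) \<Rightarrow> ('x \<Rightarrow> 'k) \<Rightarrow> 'x tm \<Rightarrow> 'k" where
  "tm_code P n f (TVar x) = P (n 0, f x)"
| "tm_code P n f TZero = P (n 1, n 0)"
| "tm_code P n f TOne = P (n 2, n 0)"
| "tm_code P n f (TJoin s t) = P (n 3, P (tm_code P n f s, tm_code P n f t))"
| "tm_code P n f (TMeet s t) = P (n 4, P (tm_code P n f s, tm_code P n f t))"
| "tm_code P n f (TComp s t) = P (n 5, P (tm_code P n f s, tm_code P n f t))"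

lemma inj_on_tm_code:
  assumes P: "inj P" and n: "inj n" and f: "inj_on f X"
  shows "inj_on (tm_code P n f) {t. vars t \<subseteq> X}"
proof -
  have [simp]: "P p = P q \<longleftrightarrow> p = q" "n i = n j \<longleftrightarrow> i = j" for p q i j
    using P n by (auto dest: injD)
  have "s = t" if "tm_code P n f s = tm_code P n f t" "vars s \<subseteq> X" "vars t \<subseteq> X" for s t
    using that
  proof (induction s arbitrary: t)
    case (TVar x)
    then show ?case using f by (cases t) (auto dest: inj_onD)
  next
    case TZero
    then show ?case by (cases t) auto
  next
    case TOne
    then show ?case by (cases t) auto
  next
    case (TJoin s1 s2)
    then show ?case by (cases t) auto
  next
    case (TMeet s1 s2)
    then show ?case by (cases t) auto
  next
    case (TComp s1 s2)
    then show ?case by (cases t) auto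
  qed
  then show ?thesis
    by (auto intro: inj_onI)
qed

lemma countable_tms: "countable X \<Longrightarrow> countable {t. vars t \<subseteq> X}"
  by (rule countableI[OF inj_on_tm_code[of prod_encode id "to_nat_on X"]])
    (auto simp: inj_prod_encode)

section \<open>Separation in a countable subalgebra\<close>

lemma finite_vars: "finite (vars t)"
  by (induction t) auto

text \<open>Two terms contain finitely many variables, so the subalgebra generated by these is
  countable and its network fits into any infinite type. By antisymmetry one of the two inequalities
  between the values fails, and that failure is what gets represented.\<close>

lemma (in integral_model) separating_integral_relation_algebra:
  fixes s t :: "'a tm"
  assumes inf: "infinite (UNIV :: 'u set)"
    and st: "vars s \<subseteq> C" "vars t \<subseteq> C" "tval A (\<lambda>x. x) s \<noteq> tval A (\<lambda>x. x) t"
  shows "\<exists>R \<in> (Rel_integral :: ('u \<times> 'u) set alg set). \<exists>w. range w \<subseteq> acarrier R \<and>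
    tval R w s \<noteq> tval R w t"
proof -
  have tval_C: "tval A (\<lambda>x. x) u \<in> C" if "vars u \<subseteq> C" for u
    using that by (induction u) auto
  have *: "\<exists>R \<in> (Rel_integral :: ('u \<times> 'u) set alg set). \<exists>w. range w \<subseteq> acarrier R \<and>
      tval R w s \<noteq> tval R w t"
    if vs: "vars s \<subseteq> C" "vars t \<subseteq> C" and n: "\<not> tval A (\<lambda>x. x) s \<preceq> tval A (\<lambda>x. x) t"
    for s t :: "'a tm"
  proof -
    obtain r where r: "compat r" "(tval A (\<lambda>x. x) s, tval A (\<lambda>x. x) t) \<notin> r"
      "\<And>x. x \<in> C \<Longrightarrow> (\<one> \<otimes> x, \<zero>) \<in> r \<or> (\<one>, x) \<in> r"
      using maximal_compat[OF tval_C[OF vs(1)] tval_C[OF vs(2)] n] by blast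
    define T where "T = {u. vars u \<subseteq> vars s \<union> vars t}"
    define D where "D = tval A (\<lambda>x. x) ` T"
    have T: "TZero \<in> T" "TOne \<in> T" "\<And>u v. \<lbrakk>u \<in> T; v \<in> T\<rbrakk> \<Longrightarrow> TJoin u v \<in> T"
      "\<And>u v. \<lbrakk>u \<in> T; v \<in> T\<rbrakk> \<Longrightarrow> TMeet u v \<in> T" "\<And>u v. \<lbrakk>u \<in> T; v \<in> T\<rbrakk> \<Longrightarrow> TComp u v \<in> T"
      by (auto simp: T_def)
    have pre: "integral_alg_preorder A D (\<lambda>x y. (x, y) \<in> r)"
    proof (rule integral_alg_preorder_compat[OF r(1,3,2) tval_C[OF vs(1)] tval_C[OF vs(2)]])
      show "D \<subseteq> C"
        using tval_C vs by (auto simp: D_def T_def)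
      show "\<zero> \<in> D" "\<one> \<in> D"
        using imageI[OF T(1), of "tval A (\<lambda>x. x)"] imageI[OF T(2), of "tval A (\<lambda>x. x)"]
        by (auto simp: D_def)
      fix x y assume "x \<in> D" "y \<in> D"
      then obtain u v where uv: "u \<in> T" "v \<in> T" "x = tval A (\<lambda>x. x) u" "y = tval A (\<lambda>x. x) v"
        by (auto simp: D_def)
      show "x \<oplus> y \<in> D" "x \<otimes> y \<in> D" "x \<odot> y \<in> D"
        using imageI[OF T(3)[OF uv(1,2)], of "tval A (\<lambda>x. x)"]
          imageI[OF T(4)[OF uv(1,2)], of "tval A (\<lambda>x. x)"]
          imageI[OF T(5)[OF uv(1,2)], of "tval A (\<lambda>x. x)"] uv
        by (simp_all add: D_def)
    qed
    have D: "countable D"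
      unfolding D_def T_def
      by (intro countable_image countable_tms) (simp add: finite_vars countable_finite)
    have vD: "vars s \<subseteq> D" "vars t \<subseteq> D"
    proof -
      have "x \<in> D" if "x \<in> vars s \<union> vars t" for x
        unfolding D_def T_def by (rule image_eqI[of _ _ "TVar x"]) (use that in auto)
      then show "vars s \<subseteq> D" "vars t \<subseteq> D" by blast+
    qed
    show ?thesis
      by (rule integral_alg_preorder.integral_relation_algebra_separating[OF pre D inf vD r(2)])
  qed
  show ?thesis
  proof (cases "tval A (\<lambda>x. x) s \<preceq> tval A (\<lambda>x. x) t")
    case True
    then have "\<not> tval A (\<lambda>x. x) t \<preceq> tval A (\<lambda>x. x) s"
      using leq_antisym st(3) by blast
    then show ?thesis
      using *[OF st(2,1)] by metis
  next
    case False
    then show ?thesis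
      using *[OF st(1,2)] by blast
  qed
qed

section \<open>Preservation of equations under homomorphic images, subalgebras and products\<close>

lemma eval_closed: "\<lbrakk>algebra A; range v \<subseteq> acarrier A\<rbrakk> \<Longrightarrow> eval A v t \<in> acarrier A"
  by (induction t) (auto simp: algebra_def)

lemma eval_homomorphism:
  assumes "algebra A" "homomorphism h A B" "range v \<subseteq> acarrier A"
  shows "h (eval A v t) = eval B (h \<circ> v) t"
  by (induction t) (use assms eval_closed[OF assms(1,3)] in \<open>auto simp: homomorphism_def\<close>)

lemma modelsI:
  assumes "algebra A"
    and "\<And>s t v. \<lbrakk>(s \<^bold>= t) \<in> E; range v \<subseteq> acarrier A\<rbrakk> \<Longrightarrow> eval A v s = eval A v t"
  shows "A \<in> models E"
proof -
  have "satisfies A e" if "e \<in> E" for e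
    using that assms(2) by (cases e) simp
  then show ?thesis
    using assms(1) by (simp add: models_def)
qed

lemma modelsD:
  assumes "A \<in> models E"
  shows "algebra A"
    and "\<lbrakk>(s \<^bold>= t) \<in> E; range v \<subseteq> acarrier A\<rbrakk> \<Longrightarrow> eval A v s = eval A v t"
proof -
  show "algebra A"
    using assms by (simp add: models_def)
  assume "(s \<^bold>= t) \<in> E" "range v \<subseteq> acarrier A"
  moreover then have "satisfies A (s \<^bold>= t)"
    using assms unfolding models_def by blast
  ultimately show "eval A v s = eval A v t"
    by simp
qed

lemma class_H_models:
  fixes K :: "'b alg set"
  assumes "K \<subseteq> models E"
  shows "class_H K \<subseteq> models E"
proof
  fix A :: "'a alg" assume "A \<in> class_H K"
  then obtain B :: "'b alg" and h where A: "algebra A" and B: "B \<in> models E"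
    and h: "homomorphism h B A" "h ` acarrier B = acarrier A"
    using assms by (auto simp: class_H_def)
  show "A \<in> models E"
  proof (rule modelsI[OF A])
    fix s t and v :: "nat \<Rightarrow> 'a"
    assume st: "(s \<^bold>= t) \<in> E" and v: "range v \<subseteq> acarrier A"
    \<comment> \<open>Surjectivity of \<open>h\<close> lifts the valuation \<open>v\<close> to one
      in \<open>B\<close>.\<close>
    have "\<forall>n. \<exists>b. b \<in> acarrier B \<and> h b = v n"
      using v h(2) by (metis imageE range_subsetD)
    then obtain u where u: "\<And>n. u n \<in> acarrier B" "\<And>n. h (u n) = v n"
      by metis
    then have ru: "range u \<subseteq> acarrier B" and hu: "h \<circ> u = v"
      by auto
    show "eval A v s = eval A v t"
      using eval_homomorphism[OF modelsD(1)[OF B] h(1) ru, of s] modelsD(2)[OF B st ru]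
        eval_homomorphism[OF modelsD(1)[OF B] h(1) ru, of t] by (simp add: hu)
  qed
qed

lemma class_S_models:
  assumes "K \<subseteq> models E"
  shows "class_S K \<subseteq> models E"
proof
  fix A :: "'a alg" assume "A \<in> class_S K"
  then obtain B where B: "B \<in> models E" and A: "algebra A" and h: "homomorphism (\<lambda>x. x) A B"
    using assms by (auto simp: class_S_def subalgebra_def)
  show "A \<in> models E"
  proof (rule modelsI[OF A])
    fix s t and v :: "nat \<Rightarrow> 'a"
    assume st: "(s \<^bold>= t) \<in> E" and v: "range v \<subseteq> acarrier A"
    then have "range v \<subseteq> acarrier B"
      using h by (auto simp: homomorphism_def)
    then show "eval A v s = eval A v t"
      using eval_homomorphism[OF A h v] modelsD(2)[OF B st] by (simp add: comp_def)
  qed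
qed

lemma algebra_product_alg: "(\<And>i. i \<in> I \<Longrightarrow> algebra (B i)) \<Longrightarrow> algebra (product_alg I B)"
  unfolding algebra_def product_alg_def by (auto simp: PiE_iff)

lemma class_P_models:
  fixes K :: "'b alg set"
  assumes "K \<subseteq> models E"
  shows "class_P K \<subseteq> models E"
proof
  fix A :: "('i \<Rightarrow> 'b) alg" assume "A \<in> class_P K"
  then obtain I B where A_eq: "A = product_alg I B" and B: "\<And>i. i \<in> I \<Longrightarrow> B i \<in> models E"
    using assms unfolding class_P_def by blast
  have A: "algebra A"
    unfolding A_eq by (intro algebra_product_alg modelsD(1)[OF B])
  have proj: "homomorphism (\<lambda>f. f i) A (B i)" if "i \<in> I" for i
    using that by (auto simp: homomorphism_def A_eq product_alg_def)
  show "A \<in> models E"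
  proof (rule modelsI[OF A])
    fix s t and v :: "nat \<Rightarrow> 'i \<Rightarrow> 'b"
    assume st: "(s \<^bold>= t) \<in> E" and v: "range v \<subseteq> acarrier A"
    show "eval A v s = eval A v t"
    proof (rule PiE_ext[where ?s = "\<lambda>i. acarrier (B i)"])
      show "eval A v s \<in> (\<Pi>\<^sub>E i\<in>I. acarrier (B i))" "eval A v t \<in> (\<Pi>\<^sub>E i\<in>I. acarrier (B i))"
        using eval_closed[OF A v] unfolding A_eq product_alg_def by simp_all
      fix i assume i: "i \<in> I"
      have "range ((\<lambda>f. f i) \<circ> v) \<subseteq> acarrier (B i)"
        using v proj[OF i] by (auto simp: homomorphism_def)
      then show "eval A v s i = eval A v t i"
        using eval_homomorphism[OF A proj[OF i] v] modelsD(2)[OF B[OF i] st] by simp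
    qed
  qed
qed

section \<open>Soundness of the axioms\<close>

text \<open>Integrality gives the two commutation laws: a relation of the algebra contains all loops
  or none. The other axioms hold for arbitrary relations on \<open>U\<close>.\<close>

lemma Rel_integral_models: "Rel_integral \<subseteq> models Ax_integral"
proof
  fix R :: "('u \<times> 'u) set alg" assume "R \<in> Rel_integral"
  then obtain U where R: "algebra R" and h: "homomorphism (\<lambda>x. x) R (full_rel_alg U)"
    and int: "integral R"
    by (auto simp: Rel_integral_def relation_algebra_def subalgebra_def)
  have sub: "x \<subseteq> U \<times> U" if "x \<in> acarrier R" for x
    using h that by (auto simp: homomorphism_def full_rel_alg_def)
  have ops: "azero R = {}" "aone R = Id_on U"
    "\<And>x y. \<lbrakk>x \<in> acarrier R; y \<in> acarrier R\<rbrakk> \<Longrightarrow> ameet R x y = x \<inter> y"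
    "\<And>x y. \<lbrakk>x \<in> acarrier R; y \<in> acarrier R\<rbrakk> \<Longrightarrow> acomp R x y = x O y"
    using h by (auto simp: homomorphism_def full_rel_alg_def)
  have atom: "Id_on U \<inter> x = {} \<or> Id_on U \<inter> x = Id_on U" if x: "x \<in> acarrier R" for x
  proof -
    have "ameet R (aone R) x \<in> acarrier R" "aone R \<in> acarrier R"
      using R x by (auto simp: algebra_def)
    then have *: "Id_on U \<inter> x \<in> acarrier R" "Id_on U \<in> acarrier R"
      using ops x by auto
    then have "ameet R (Id_on U \<inter> x) (Id_on U) = Id_on U \<inter> x"
      using ops by auto
    then show ?thesis
      using int * ops unfolding integral_def by metis
  qed
  have central: "(Id_on U \<inter> x) O y = y O (Id_on U \<inter> x)"
    if xy: "x \<in> acarrier R" "y \<in> acarrier R" for x y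
    using atom[OF xy(1)] sub[OF xy(2)] by auto
  have cyc: "Id_on U \<inter> (x O y) \<subseteq> Id_on U \<inter> (y O x)"
    if xy: "x \<in> acarrier R" "y \<in> acarrier R" for x y
  proof
    fix p assume p: "p \<in> Id_on U \<inter> (x O y)"
    then obtain u v where "(u, v) \<in> x" "(v, u) \<in> y" by auto
    \<comment> \<open>The walk from \<open>v\<close> to \<open>u\<close> and back is a loop at
      \<open>v\<close> in \<open>y O x\<close>; by atomicity all loops are then present, including
      \<open>p\<close>.\<close>
    then have "Id_on U \<inter> (y O x) \<noteq> {}"
      using sub[OF xy(1)] by auto
    moreover have "y O x \<in> acarrier R"
      using R xy ops(4)[OF xy(2,1)] unfolding algebra_def by metis
    ultimately show "p \<in> Id_on U \<inter> (y O x)"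
      using atom[of "y O x"] p by blast
  qed
  have eval: "eval R v t = eval (full_rel_alg U) v t" if "range v \<subseteq> acarrier R" for v t
    using eval_homomorphism[OF R h that, of t] by (simp add: comp_def)
  have relcomp_mono_eq: "((x \<inter> x') O (y \<inter> y')) \<inter> (x O y) = (x \<inter> x') O (y \<inter> y')"
    for x x' y y' :: "('u \<times> 'u) set"
    by blast
  have subid_comp: "(Id_on U \<inter> x) O (Id_on U \<inter> y) = Id_on U \<inter> x \<inter> y"
    "(Id_on U \<inter> x) O (y \<inter> z) = ((Id_on U \<inter> x) O y) \<inter> z"
    "(x \<inter> y) O (Id_on U \<inter> z) = x \<inter> (y O (Id_on U \<inter> z))" for x y z
    by auto
  show "R \<in> models Ax_integral"
  proof (rule modelsI[OF R])
    fix s t and v :: "nat \<Rightarrow> ('u \<times> 'u) set"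
    assume st: "(s \<^bold>= t) \<in> Ax_integral" and v: "range v \<subseteq> acarrier R"
    then have vc: "v n \<in> acarrier R" for n by auto
    have unit: "Id_on U O v 0 = v 0" "v 0 O Id_on U = v 0"
      using sub[OF vc[of 0]] by auto
    have cyc_eq: "Id_on U \<inter> (v 0 O v (Suc 0)) = Id_on U \<inter> (v (Suc 0) O v 0)"
      using cyc[OF vc[of 0] vc[of "Suc 0"]] cyc[OF vc[of "Suc 0"] vc[of 0]] by blast
    from st show "eval R v s = eval R v t"
      unfolding eval[OF v] Ax_integral_def Ax_distrib_lattice_def Ax_monoid_def Let_def
      by (elim UnE insertE emptyE)
        (simp_all add: full_rel_alg_def O_assoc relcomp_mono_eq unit,
          (rule subid_comp central[OF vc vc] cyc_eq Un_commute Int_commute Un_assoc Int_assoc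
            Int_Un_distrib Un_Int_distrib)+)
  qed
qed

section \<open>Membership in the variety from separation of terms\<close>

lemma tval_product_alg:
  "i \<in> I \<Longrightarrow> tval (product_alg I B) W t i = tval (B i) (\<lambda>x. W x i) t"
  by (induction t) (auto simp: product_alg_def)

lemma tval_closed: "\<lbrakk>algebra A; v ` vars t \<subseteq> acarrier A\<rbrakk> \<Longrightarrow> tval A v t \<in> acarrier A"
  by (induction t) (auto simp: algebra_def)

text \<open>Terms over the elements of \<open>A\<close> are evaluated in a product with one factor
  for each pair of terms that differ in \<open>A\<close>. Terms equal in the product are then equal
  in \<open>A\<close>, so sending the value in the product to the value in \<open>A\<close> is a
  well-defined homomorphism onto \<open>A\<close>.\<close>

lemma variety_generated_if_separated:
  fixes A :: "'a alg" and K :: "'b alg set"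
  assumes A: "algebra A" and K: "\<And>R. R \<in> K \<Longrightarrow> algebra R"
    and sep: "\<And>s t. \<lbrakk>vars s \<subseteq> acarrier A; vars t \<subseteq> acarrier A;
      tval A (\<lambda>x. x) s \<noteq> tval A (\<lambda>x. x) t\<rbrakk>
      \<Longrightarrow> \<exists>R\<in>K. \<exists>w. range w \<subseteq> acarrier R \<and> tval R w s \<noteq> tval R w t"
    and inf: "infinite (UNIV :: 'i set)" and f: "inj (f :: 'a \<Rightarrow> 'i)"
  shows "A \<in> variety_generated TYPE('i) K"
proof -
  obtain P :: "'i \<times> 'i \<Rightarrow> 'i" where "bij_betw P (UNIV \<times> UNIV) UNIV"
    using card_of_Times_same_infinite[OF inf, folded card_of_ordIso] by blast
  then have P: "inj P"
    by (simp add: bij_betw_def)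
  obtain n :: "nat \<Rightarrow> 'i" where n: "inj n"
    using inf infinite_countable_subset by blast
  define cd where "cd = tm_code P n f"
  have cd: "inj cd"
    using inj_on_tm_code[OF P n f] by (simp add: cd_def)
  \<comment> \<open>Index sets must lie in \<open>'i\<close>, so pairs of terms are represented by
    codes.\<close>
  define q where "q = (\<lambda>(s, t). P (cd s, cd t))"
  have q: "inj q"
    by (auto simp: q_def inj_eq[OF P] inj_eq[OF cd] intro!: injI)
  define T where "T = {t. vars t \<subseteq> acarrier A}"
  define Bad where "Bad = {(s, t). s \<in> T \<and> t \<in> T \<and> tval A (\<lambda>x. x) s \<noteq> tval A (\<lambda>x. x) t}"
  have "\<forall>p\<in>Bad. \<exists>R w. R \<in> K \<and> range w \<subseteq> acarrier R \<and> tval R w (fst p) \<noteq> tval R w (snd p)"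
  proof
    fix p assume "p \<in> Bad"
    then show "\<exists>R w. R \<in> K \<and> range w \<subseteq> acarrier R \<and> tval R w (fst p) \<noteq> tval R w (snd p)"
      using sep[of "fst p" "snd p"] unfolding Bad_def T_def by fastforce
  qed
  then obtain Rf wf where RW: "\<And>p. p \<in> Bad \<Longrightarrow> Rf p \<in> K"
    "\<And>p x. p \<in> Bad \<Longrightarrow> wf p x \<in> acarrier (Rf p)"
    "\<And>p. p \<in> Bad \<Longrightarrow> tval (Rf p) (wf p) (fst p) \<noteq> tval (Rf p) (wf p) (snd p)"
    by (metis range_subsetD)
  define I where "I = q ` Bad"
  define B where "B i = Rf (inv q i)" for i
  \<comment> \<open>Each coordinate uses the valuation that separates its pair; the restriction to
    \<open>I\<close> matches the extensional functions in the carrier of the product.\<close>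
  define W where "W x = (\<lambda>i\<in>I. wf (inv q i) x)" for x
  define Q where "Q = product_alg I B"
  have inv: "inv q i \<in> Bad" if "i \<in> I" for i
    using that q by (auto simp: I_def)
  then have BK: "B i \<in> K" if "i \<in> I" for i
    using that RW by (simp add: B_def)
  then have Q: "algebra Q"
    unfolding Q_def by (intro algebra_product_alg K)
  have W: "W x \<in> acarrier Q" for x
    using inv RW(2) by (auto simp: W_def Q_def product_alg_def B_def)
  have unique: "tval A (\<lambda>x. x) s = tval A (\<lambda>x. x) t"
    if "s \<in> T" "t \<in> T" "tval Q W s = tval Q W t" for s t
  proof (rule ccontr)
    assume "tval A (\<lambda>x. x) s \<noteq> tval A (\<lambda>x. x) t"
    then have bad: "(s, t) \<in> Bad"
      using that by (simp add: Bad_def)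
    define i where "i = q (s, t)"
    have i: "i \<in> I" "inv q i = (s, t)"
      using bad q by (auto simp: i_def I_def)
    then have "(\<lambda>x. W x i) = wf (s, t)" "B i = Rf (s, t)"
      by (auto simp: W_def B_def)
    then have "tval (Rf (s, t)) (wf (s, t)) s = tval (Rf (s, t)) (wf (s, t)) t"
      using tval_product_alg[OF i(1), of B W] that(3) unfolding Q_def by metis
    then show False
      using RW(3)[OF bad] by simp
  qed
  \<comment> \<open>The subalgebra of \<open>Q\<close> generated by the elements \<open>W x\<close>
    with \<open>x\<close> in the carrier of \<open>A\<close>.\<close>
  define S where "S = Q\<lparr>acarrier := tval Q W ` T\<rparr>"
  have T: "TZero \<in> T" "TOne \<in> T" "\<And>u v. \<lbrakk>u \<in> T; v \<in> T\<rbrakk> \<Longrightarrow> TJoin u v \<in> T"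
    "\<And>u v. \<lbrakk>u \<in> T; v \<in> T\<rbrakk> \<Longrightarrow> TMeet u v \<in> T" "\<And>u v. \<lbrakk>u \<in> T; v \<in> T\<rbrakk> \<Longrightarrow> TComp u v \<in> T"
    by (auto simp: T_def)
  have image: "azero Q \<in> tval Q W ` T" "aone Q \<in> tval Q W ` T"
    "\<And>u v. \<lbrakk>u \<in> T; v \<in> T\<rbrakk> \<Longrightarrow> ajoin Q (tval Q W u) (tval Q W v) \<in> tval Q W ` T"
    "\<And>u v. \<lbrakk>u \<in> T; v \<in> T\<rbrakk> \<Longrightarrow> ameet Q (tval Q W u) (tval Q W v) \<in> tval Q W ` T"
    "\<And>u v. \<lbrakk>u \<in> T; v \<in> T\<rbrakk> \<Longrightarrow> acomp Q (tval Q W u) (tval Q W v) \<in> tval Q W ` T"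
    using T by (metis image_eqI tval.simps)+
  have "algebra S"
    using image by (auto simp: algebra_def S_def)
  moreover have "tval Q W ` T \<subseteq> acarrier Q"
    using tval_closed[OF Q, of W] W by (simp add: image_subset_iff)
  ultimately have "subalgebra S Q"
    by (simp add: subalgebra_def homomorphism_def S_def)
  moreover have "Q \<in> class_P K"
    using BK unfolding class_P_def Q_def by blast
  ultimately have S: "S \<in> class_S (class_P K)"
    unfolding class_S_def by blast
  \<comment> \<open>By \<open>unique\<close> the choice of the term does not affect its value in
    \<open>A\<close>.\<close>
  define h where "h p = tval A (\<lambda>x. x) (SOME t. t \<in> T \<and> tval Q W t = p)" for p
  have h: "h (tval Q W t) = tval A (\<lambda>x. x) t" if "t \<in> T" for t
  proof -
    define u where "u = (SOME u. u \<in> T \<and> tval Q W u = tval Q W t)"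
    have "u \<in> T \<and> tval Q W u = tval Q W t"
      unfolding u_def by (rule someI[of _ t]) (use that in simp)
    then have "tval A (\<lambda>x. x) u = tval A (\<lambda>x. x) t"
      using unique that by blast
    then show ?thesis
      by (simp only: h_def flip: u_def)
  qed
  have hom: "h (ajoin Q (tval Q W u) (tval Q W v)) = ajoin A (h (tval Q W u)) (h (tval Q W v))"
    "h (ameet Q (tval Q W u) (tval Q W v)) = ameet A (h (tval Q W u)) (h (tval Q W v))"
    "h (acomp Q (tval Q W u) (tval Q W v)) = acomp A (h (tval Q W u)) (h (tval Q W v))"
    if "u \<in> T" "v \<in> T" for u v
    using h[OF T(3)[OF that]] h[OF T(4)[OF that]] h[OF T(5)[OF that]] h that by simp_all
  have hA: "h ` acarrier S = acarrier A"
  proof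
    show "h ` acarrier S \<subseteq> acarrier A"
      using h tval_closed[OF A, of "\<lambda>x. x"] by (auto simp: S_def T_def)
    show "acarrier A \<subseteq> h ` acarrier S"
    proof
      fix x assume "x \<in> acarrier A"
      then have "TVar x \<in> T"
        by (simp add: T_def)
      then show "x \<in> h ` acarrier S"
        using h[of "TVar x"] by (force simp: S_def)
    qed
  qed
  moreover have "homomorphism h S A"
    using hA h[OF T(1)] h[OF T(2)] hom unfolding homomorphism_def S_def by simp
  ultimately show ?thesis
    using S A unfolding variety_generated_def class_H_def by blast
qed

text \<open>Soundness is inherited by products, subalgebras and homomorphic images. Conversely,
  terms with different values in a model are separated by an integral relation algebra, which
  suffices for membership in the variety.\<close>

theorem theorem2p2:
  assumes "infinite (UNIV :: 'u set)"
    and "infinite (UNIV :: 'i set)"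
    and "\<exists>f :: 'a \<Rightarrow> 'i. inj f"
  shows "variety_generated TYPE('i) (Rel_integral :: ('u \<times> 'u) set alg set)
           = (models Ax_integral :: 'a alg set)"
proof
  show "variety_generated TYPE('i) (Rel_integral :: ('u \<times> 'u) set alg set)
      \<subseteq> (models Ax_integral :: 'a alg set)"
    unfolding variety_generated_def
    by (intro class_H_models class_S_models class_P_models Rel_integral_models)
next
  obtain f :: "'a \<Rightarrow> 'i" where f: "inj f"
    using assms(3) by blast
  show "(models Ax_integral :: 'a alg set)
      \<subseteq> variety_generated TYPE('i) (Rel_integral :: ('u \<times> 'u) set alg set)"
  proof
    fix A :: "'a alg" assume A: "A \<in> models Ax_integral"
    then interpret integral_model A
      by unfold_locales
    show "A \<in> variety_generated TYPE('i) (Rel_integral :: ('u \<times> 'u) set alg set)"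
    proof (rule variety_generated_if_separated[OF _ _ _ assms(2) f])
      show "algebra A"
        using A by (simp add: models_def)
      show "algebra R" if "R \<in> Rel_integral" for R :: "('u \<times> 'u) set alg"
        using that Rel_integral_models by (auto simp: models_def)
    qed (rule separating_integral_relation_algebra[OF assms(1)])
  qed
qed

end
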